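(* Let $d,L\in\{1,2,3,\dots\}$, let $p>0$ and $\delta\ge 0$ be integers, and let $\mathsf{GNN}_{\mathsf{slp}}(d,L)$ be the class of $L$-layer simple GNNs of width $d$ with single-layer perceptrons, using (fixed) piece-wise polynomial activation functions $\sigma_1,\dots,\sigma_{L+1}$ with $p$ pieces and degree $\delta$. Let $P = d(2dL+L+1)+1$ be the number of parameters in the GNNs. Then for all $u\in\{1,2,3,\dots\}$, $$\mathsf{VC}\text{-}\mathsf{dim}_{\mathcal{G}_{d,\leq u}}\bigl(\mathsf{GNN}_{\mathsf{slp}}(d,L)\bigr)\leq \begin{cases} \mathcal{O}(P\log(puP)) & \text{if } \delta=0,\\ \mathcal{O}(LP\log(puP)) & \text{if } \delta=1,\\ \mathcal{O}(LP\log(puP)+L^2P\log(\delta)) & \text{if } \delta>1, \end{cases}$$ where $\mathcal{G}_{d,\leq u}$ is the class of all graphs with $d$-dimensional real vertex features of color complexity at most $u$, and the $\mathcal{O}$-constants are absolute.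
   Context: **Graphs.** Graphs are finite, undirected, without self-loops; $N(v)$ is the neighborhood of $v$. A graph with $d$-dimensional features is a pair $\mathbf{G}=(G,\mathbf{L})$ with $V(G)=[|V(G)|]$ and $\mathbf{L}\in\mathbb{R}^{|V(G)|\times d}$; the feature of $v$ is the row $\mathbf{L}_{v\cdot}$. **$1$-WL and color complexity.** The $1$-dimensional Weisfeiler--Leman algorithm computes vertex colorings $C_t^1$: $C^1_0(v)$ is determined by the feature of $v$ (same color iff same feature), and for $t>0$ $$C^1_t(v) = \mathsf{RELABEL}\bigl(C^1_{t-1}(v), \{\!\!\{ C^1_{t-1}(u) \mid u \in N(v)\}\!\!\}\bigr)$$ with $\mathsf{RELABEL}$ an injective map to fresh colors. The color complexity of a graph is the number of colors computed by $1$-WL after $|V(G)|$ iterations on that graph, i.e. the number of distinct values of $C^1_{|V(G)|}$ on $V(G)$. $\mathcal{G}_{d,\leq u}$ is the class of all graphs, of arbitrary order, with $d$-dimensional features and color complexity at most $u$. **The GNN class.** Given activation functions $\sigma_1,\dots,\sigma_{L+1}:\mathbb{R}\to\mathbb{R}$ (applied coordinatewise), the GNNs in $\mathsf{GNN}_{\mathsf{slp}}(d,L)$ compute $\mathbf{h}_v^{(0)}=\mathbf{L}_{v\cdot}$, $$\mathbf{h}_{v}^{(t)} = \sigma_t\Bigl(\mathbf{h}_{v}^{(t-1)}\mathbf{W}_1^{(t)}+\sum_{u\in N(v)}\mathbf{h}_{u}^{(t-1)}\mathbf{W}_2^{(t)}+\mathbf{b}^{(t)}\Bigr)\in\mathbb{R}^d\quad(t\in[L]),$$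 $$\mathsf{gnn}(\mathbf{G}) = \sigma_{L+1}\Bigl(\sum_{v\in V(G)}\mathbf{h}_{v}^{(L)}\mathbf{w}+b\Bigr)\in\mathbb{R},$$ with parameters $\mathbf{W}_1^{(t)},\mathbf{W}_2^{(t)}\in\mathbb{R}^{d\times d}$, $\mathbf{b}^{(t)}\in\mathbb{R}^{1\times d}$, $\mathbf{w}\in\mathbb{R}^{d\times 1}$, $b\in\mathbb{R}$, which together form a vector $\Theta\in\mathbb{R}^{P}$. The class consists of these GNNs for all $\Theta\in\mathbb{R}^P$. **Piece-wise polynomial activation.** An activation function with $p$ pieces and degree $\delta$ is a function $\sigma:\mathbb{R}\to\mathbb{R}$ given by a partition of $\mathbb{R}$ into $p$ intervals $I_1,\dots,I_p$ and polynomials $p_1,\dots,p_p$ of degree at most $\delta$, with $\sigma(x)=p_j(x)$ for $x\in I_j$. **VC dimension.** For a class $\mathcal{C}$ of GNNs and a class $\mathcal{X}$ of graphs, graphs $\mathbf{G}_1,\dots,\mathbf{G}_m\in\mathcal{X}$ are shattered by $\mathcal{C}$ if for every $\tau\in\{0,1\}^m$ there is $\mathsf{gnn}\in\mathcal{C}$ such that for all $i\in[m]$: $\mathsf{gnn}(\mathbf{G}_i)\ge 2/3$ if $\tau_i=1$ and $\mathsf{gnn}(\mathbf{G}_i)\le 1/3$ if $\tau_i=0$. $\mathsf{VC}\text{-}\mathsf{dim}_{\mathcal{X}}(\mathcal{C})$ is the maximal $m$ such that some $m$ graphs in $\mathcal{X}$ are shattered by $\mathcal{C}$. *)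

theory Defs
  imports
    "HOL-Analysis.Topology_Euclidean_Space"
    "HOL-Library.Multiset"
    "HOL-Library.Disjoint_Sets"
    "HOL-Library.Extended_Real"
    "HOL-Computational_Algebra.Polynomial"
    "Jordan_Normal_Form.Matrix"
begin

(* Both Euclidean-space and matrix theories use the bullet; here it is the matrix one. *)
no_notation inner (infix "\<bullet>" 70)

(* The vertex set [n] is rendered as {..<n} rather than {1..n}, so that the vertices are exactly
   the row indices of the feature matrix. *)
record fgraph =
  num_verts :: nat
  edges :: "nat set set"
  features :: "real mat"

definition verts :: "fgraph \<Rightarrow> nat set" where
  "verts G = {..<num_verts G}"

definition nbh :: "fgraph \<Rightarrow> nat \<Rightarrow> nat set" where
  "nbh G v = {u \<in> verts G. {u, v} \<in> edges G}"

definition featured_graph :: "nat \<Rightarrow> fgraph \<Rightarrow> bool" where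
  "featured_graph d G \<longleftrightarrow>
     (\<forall>e\<in>edges G. e \<subseteq> verts G \<and> card e = 2) \<and>
     features G \<in> carrier_mat (num_verts G) d"

(* RELABEL is realized as a free constructor: it is injective, and it never returns a colour
   that already occurred among its arguments or in an earlier round. *)
datatype color = Feature "real vec" | Relabel color "color multiset"

primrec wl :: "fgraph \<Rightarrow> nat \<Rightarrow> nat \<Rightarrow> color" where
  "wl G 0 v = Feature (row (features G) v)"
| "wl G (Suc t) v = Relabel (wl G t v) (image_mset (wl G t) (mset_set (nbh G v)))"

definition color_complexity :: "fgraph \<Rightarrow> nat" where
  "color_complexity G = card (wl G (num_verts G) ` verts G)"

definition graph_class :: "nat \<Rightarrow> nat \<Rightarrow> fgraph set" where
  "graph_class d u = {G. featured_graph d G \<and> color_complexity G \<le> u}"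

definition piecewise_polynomial :: "nat \<Rightarrow> nat \<Rightarrow> (real \<Rightarrow> real) \<Rightarrow> bool" where
  "piecewise_polynomial p \<delta> \<sigma> \<longleftrightarrow>
     (\<exists>\<I>. partition_on UNIV \<I> \<and> finite \<I> \<and> card \<I> = p \<and>
        (\<forall>I\<in>\<I>. is_interval I \<and>
           (\<exists>q :: real poly. degree q \<le> \<delta> \<and> (\<forall>x\<in>I. \<sigma> x = poly q x))))"

(* The fields W1, W2 and bias are indexed by the layers 1, ..., L; values at other indices
   are never used. *)
record gnn_params =
  W1 :: "nat \<Rightarrow> real mat"
  W2 :: "nat \<Rightarrow> real mat"
  bias :: "nat \<Rightarrow> real vec"
  w_out :: "real vec"
  b_out :: real

definition gnn_param_space :: "nat \<Rightarrow> nat \<Rightarrow> gnn_params set" where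
  "gnn_param_space d L =
     {\<Theta>. (\<forall>t\<in>{1..L}. W1 \<Theta> t \<in> carrier_mat d d \<and> W2 \<Theta> t \<in> carrier_mat d d \<and>
            bias \<Theta> t \<in> carrier_vec d) \<and>
          w_out \<Theta> \<in> carrier_vec d}"

(* d * (2 * d + 1) parameters in each of the L layers and d + 1 in the readout. *)
definition num_params :: "nat \<Rightarrow> nat \<Rightarrow> nat" where
  "num_params d L = d * (2 * d * L + L + 1) + 1"

(* Entry j of the row vector h W is the scalar product of h with column j of W. *)
primrec gnn_layer ::
  "nat \<Rightarrow> (nat \<Rightarrow> real \<Rightarrow> real) \<Rightarrow> gnn_params \<Rightarrow> fgraph \<Rightarrow> nat \<Rightarrow> nat \<Rightarrow> real vec" where
  "gnn_layer d \<sigma> \<Theta> G 0 v = row (features G) v"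
| "gnn_layer d \<sigma> \<Theta> G (Suc t) v =
     vec d (\<lambda>j. \<sigma> (Suc t)
       (gnn_layer d \<sigma> \<Theta> G t v \<bullet> col (W1 \<Theta> (Suc t)) j
        + (\<Sum>u\<in>nbh G v. gnn_layer d \<sigma> \<Theta> G t u \<bullet> col (W2 \<Theta> (Suc t)) j)
        + bias \<Theta> (Suc t) $ j))"

definition gnn ::
  "nat \<Rightarrow> nat \<Rightarrow> (nat \<Rightarrow> real \<Rightarrow> real) \<Rightarrow> gnn_params \<Rightarrow> fgraph \<Rightarrow> real" where
  "gnn d L \<sigma> \<Theta> G =
     \<sigma> (Suc L) ((\<Sum>v\<in>verts G. gnn_layer d \<sigma> \<Theta> G L v \<bullet> w_out \<Theta>) + b_out \<Theta>)"

definition GNN_slp :: "nat \<Rightarrow> nat \<Rightarrow> (nat \<Rightarrow> real \<Rightarrow> real) \<Rightarrow> (fgraph \<Rightarrow> real) set" where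
  "GNN_slp d L \<sigma> = gnn d L \<sigma> ` gnn_param_space d L"

definition shattered :: "('a \<Rightarrow> real) set \<Rightarrow> nat \<Rightarrow> (nat \<Rightarrow> 'a) \<Rightarrow> bool" where
  "shattered C m x \<longleftrightarrow>
     (\<forall>\<tau> :: nat \<Rightarrow> bool. \<exists>f\<in>C. \<forall>i<m.
        (\<tau> i \<longrightarrow> f (x i) \<ge> 2 / 3) \<and> (\<not> \<tau> i \<longrightarrow> f (x i) \<le> 1 / 3))"

(* Infinite if arbitrarily large families are shattered. *)
definition VC_dim :: "'a set \<Rightarrow> ('a \<Rightarrow> real) set \<Rightarrow> enat" where
  "VC_dim X C = Sup {enat m | m. \<exists>x. (\<forall>i<m. x i \<in> X) \<and> shattered C m x}"

end

theory Submission
  imports Defs "HOL-Analysis.Function_Topology"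
begin

text \<open>The parameter space is subdivided layer by layer into cells on which every feature is a
  polynomial in the parameters: the signs of the preactivations relative to the breakpoints of the
  activation functions determine the pieces used. By the stabilisation of 1-WL, at most \<open>u\<close> vertices
  per graph have to be considered. Shattering \<open>m\<close> graphs requires \<open>2 ^ m\<close> cells, and the number of
  cells is controlled by a Warren-type bound: \<open>M\<close> polynomials of degree \<open>D\<close> in \<open>n\<close> variables have at
  most \<open>(4 * M * D + 2) ^ n\<close> sign patterns. That bound avoids Bezout's theorem and Sard's theorem:
  after the perturbation \<open>\<epsilon> * (\<Sum>i. x i ^ (N + 1))\<close> the critical point equations have the form
  \<open>x i ^ N = g i x\<close> with \<open>g i\<close> of degree below \<open>N\<close>, and such a system has at most \<open>N ^ n\<close> solutions by
  linear algebra.\<close>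

no_notation inner (infix "\<bullet>" 70)
no_notation Finite_Cartesian_Product.vec_nth (infixl "$" 90)

section \<open>Polynomial functions and a Bezout-type bound\<close>

text \<open>The shape of the bound is decided by exponents. Cutting the cells at one layer uses at
  most \<open>m * (u * d) * (2 * p)\<close> polynomials and multiplies the number of cells by a
  power whose exponent is the number of variables involved. For positive \<delta>, each of the L
  layers, the readout and the final comparison with 1/2 may involve all P parameters, which gives
  the exponent \<open>(L + 2) * P\<close> and thus the factor L. The degrees stay below
  \<open>(L + 1) * \<delta> ^ (L + 1)\<close>; the logarithm of this, times L * P, is the source of
  the term L^2 P log \<delta>. The order of the graphs never enters: sums over neighbours or
  vertices do not raise degrees, and only one vertex per colour needs to be tested against the
  breakpoints. The choice of these vertices depends on the graph alone, so it is the same for all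
  parameters. Since m occurs on both sides of \<open>2 ^ m \<le> (a * m + 2) ^ E\<close>, this still
  has to be solved for m, which costs only a constant factor. Polynomials are treated as functions
  with a degree bound, because only their values, zeros and partial derivatives matter.\<close>

inductive_set poly_funs :: "'i set \<Rightarrow> nat \<Rightarrow> (('i \<Rightarrow> real) \<Rightarrow> real) set"
  for I :: "'i set" and D :: nat where
  monomial: "(\<Sum>i\<in>I. \<alpha> i) \<le> D \<Longrightarrow> (\<lambda>x. c * (\<Prod>i\<in>I. x i ^ \<alpha> i)) \<in> poly_funs I D"
| add: "f \<in> poly_funs I D \<Longrightarrow> g \<in> poly_funs I D \<Longrightarrow> (\<lambda>x. f x + g x) \<in> poly_funs I D"

lemma poly_funs_const: "(\<lambda>x. c) \<in> poly_funs I D"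
  using poly_funs.monomial[of "\<lambda>_. 0" I D c] by simp

lemma poly_funs_mono_degree:
  assumes "f \<in> poly_funs I D" "D \<le> D'"
  shows "f \<in> poly_funs I D'"
  using assms(1)
proof induction
  case (monomial \<alpha> c)
  then show ?case using assms(2) by (intro poly_funs.monomial) simp
qed (rule poly_funs.add)

lemma poly_funs_mono_vars:
  assumes "f \<in> poly_funs I D" "I \<subseteq> J" "finite J"
  shows "f \<in> poly_funs J D"
  using assms(1)
proof induction
  case (monomial \<alpha> c)
  let ?\<beta> = "\<lambda>i. if i \<in> I then \<alpha> i else 0"
  have "(\<Sum>i\<in>J. ?\<beta> i) = (\<Sum>i\<in>I. \<alpha> i)"
    using assms by (intro sum.mono_neutral_cong_right) auto
  moreover have "(\<Prod>i\<in>J. x i ^ ?\<beta> i) = (\<Prod>i\<in>I. x i ^ \<alpha> i)" for x :: "_ \<Rightarrow> real"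
    using assms by (intro prod.mono_neutral_cong_right) auto
  ultimately show ?case using poly_funs.monomial[of ?\<beta> J D c] monomial by simp
qed (rule poly_funs.add)

text \<open>Needed for \<delta> = 0, where a layer's outputs are constant on cells and all variables
  used so far can be forgotten.\<close>

lemma poly_funs_degree_0:
  assumes "f \<in> poly_funs I 0" "finite I"
  shows "f \<in> poly_funs {} 0"
  using assms(1)
proof induction
  case (monomial \<alpha> c)
  then have "\<alpha> i = 0" if "i \<in> I" for i using that assms(2) by auto
  then have "(\<Prod>i\<in>I. x i ^ \<alpha> i) = 1" for x :: "_ \<Rightarrow> real" by (simp add: prod.neutral)
  then show ?case using poly_funs_const[of c "{}" 0] by simp
qed (rule poly_funs.add)

lemma poly_funs_var:
  assumes "i \<in> I" "finite I" "1 \<le> D"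
  shows "(\<lambda>x. x i) \<in> poly_funs I D"
proof -
  let ?\<alpha> = "\<lambda>j. if j = i then 1 else 0 :: nat"
  have "(\<Prod>j\<in>I. x j ^ ?\<alpha> j) = x i" for x :: "_ \<Rightarrow> real"
  proof -
    have "(\<Prod>j\<in>I. x j ^ ?\<alpha> j) = (\<Prod>j\<in>I. if j = i then x j else 1)"
      by (intro prod.cong) auto
    then show ?thesis using assms by simp
  qed
  moreover have "(\<Sum>j\<in>I. ?\<alpha> j) \<le> D" using assms by simp
  ultimately show ?thesis using poly_funs.monomial[of ?\<alpha> I D 1] by simp
qed

lemma poly_funs_mult:
  assumes "f \<in> poly_funs I D" "g \<in> poly_funs I E"
  shows "(\<lambda>x. f x * g x) \<in> poly_funs I (D + E)"
  using assms(1)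
proof induction
  case (monomial \<alpha> c)
  show ?case using assms(2)
  proof induction
    case (monomial \<beta> b)
    have "(\<lambda>x. c * b * (\<Prod>i\<in>I. x i ^ (\<alpha> i + \<beta> i))) \<in> poly_funs I (D + E)"
      using monomial \<open>sum \<alpha> I \<le> D\<close> by (intro poly_funs.monomial) (simp add: sum.distrib)
    then show ?case by (simp add: power_add prod.distrib mult_ac)
  next
    case (add f g)
    then show ?case by (simp add: distrib_left poly_funs.add)
  qed
next
  case (add f g)
  then show ?case by (simp add: distrib_right poly_funs.add)
qed

lemma poly_funs_cmult: "f \<in> poly_funs I D \<Longrightarrow> (\<lambda>x. c * f x) \<in> poly_funs I D"
  using poly_funs_mult[OF poly_funs_const[of c I 0]] by fastforce

lemma poly_funs_diff:
  "f \<in> poly_funs I D \<Longrightarrow> g \<in> poly_funs I D \<Longrightarrow> (\<lambda>x. f x - g x) \<in> poly_funs I D"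
  using poly_funs.add[OF _ poly_funs_cmult[of g I D "-1"]] by force

lemma poly_funs_sum:
  "(\<And>a. a \<in> A \<Longrightarrow> f a \<in> poly_funs I D) \<Longrightarrow> (\<lambda>x. \<Sum>a\<in>A. f a x) \<in> poly_funs I D"
  by (induction A rule: infinite_finite_induct) (simp_all add: poly_funs_const poly_funs.add)

lemma poly_funs_prod:
  "(\<And>a. a \<in> A \<Longrightarrow> f a \<in> poly_funs I D) \<Longrightarrow> (\<lambda>x. \<Prod>a\<in>A. f a x) \<in> poly_funs I (card A * D)"
proof (induction A rule: infinite_finite_induct)
  case (insert a A)
  then have "(\<lambda>x. f a x * (\<Prod>a\<in>A. f a x)) \<in> poly_funs I (D + card A * D)"
    by (intro poly_funs_mult) auto
  then show ?case using insert by simp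
qed (simp_all add: poly_funs_const)

lemma poly_funs_power: "f \<in> poly_funs I D \<Longrightarrow> (\<lambda>x. f x ^ k) \<in> poly_funs I (k * D)"
  using poly_funs_prod[of "{..<k}" "\<lambda>_. f" I D] by simp

lemma poly_funs_poly:
  assumes "f \<in> poly_funs I D" "degree q \<le> \<delta>"
  shows "(\<lambda>x. poly q (f x)) \<in> poly_funs I (\<delta> * D)"
  unfolding poly_altdef
  using assms by (intro poly_funs_sum poly_funs_cmult)
    (auto intro!: poly_funs_mono_degree[OF poly_funs_power[OF assms(1)]] mult_right_mono)

lemma continuous_on_poly_funs:
  assumes "f \<in> poly_funs I D"
  shows "continuous_on A f"
  using assms
proof induction
  case (monomial \<alpha> c)
  have "continuous_on A (\<lambda>x. x i)" for i :: 'a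
    by (rule continuous_on_subset[OF continuous_on_product_coordinates]) simp
  then show ?case by (intro continuous_intros)
qed (rule continuous_on_add)

text \<open>One coordinate at a time is enough, because an interior maximum makes every partial
  derivative vanish. The drop to \<open>D - 1\<close> later puts the right-hand sides of the
  critical point equations below degree \<open>N\<close>.\<close>

lemma poly_funs_partial_derivative:
  assumes "f \<in> poly_funs I D" "finite I" "i \<in> I"
  shows "\<exists>f' \<in> poly_funs I (D - 1). \<forall>x. ((\<lambda>t. f (x(i := t))) has_real_derivative f' x) (at (x i))"
  using assms(1)
proof induction
  case (monomial \<alpha> c)
  define \<beta> where "\<beta> = \<alpha>(i := \<alpha> i - 1)"
  let ?f' = "\<lambda>x. c * real (\<alpha> i) * (\<Prod>j\<in>I. x j ^ \<beta> j)"
  have split: "(\<Prod>j\<in>I. x j ^ \<gamma> j) = x i ^ \<gamma> i * (\<Prod>j\<in>I - {i}. x j ^ \<gamma> j)"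
    for x :: "_ \<Rightarrow> real" and \<gamma>
    using assms by (simp add: prod.remove)
  have "?f' \<in> poly_funs I (D - 1)"
  \<comment> \<open>If \<open>\<alpha> i = 0\<close>, truncated subtraction leaves the exponents
    unchanged and their sum may exceed \<open>D - 1\<close>; the factor
    \<open>real (\<alpha> i)\<close> then makes the function zero.\<close>
  proof (cases "\<alpha> i = 0")
    case True
    then show ?thesis using poly_funs_const[of 0] by simp
  next
    case False
    have "sum \<alpha> I = \<alpha> i + sum \<alpha> (I - {i})" "sum \<beta> I = \<alpha> i - 1 + sum \<alpha> (I - {i})"
      using assms by (simp_all add: sum.remove \<beta>_def)
    then show ?thesis using monomial False by (intro poly_funs.monomial) simp
  qed
  moreover have "((\<lambda>t. c * (\<Prod>j\<in>I. (x(i := t)) j ^ \<alpha> j)) has_real_derivative ?f' x) (at (x i))" for x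
  proof -
    have "(\<lambda>t. c * (\<Prod>j\<in>I. (x(i := t)) j ^ \<alpha> j)) = (\<lambda>t. c * (t ^ \<alpha> i * (\<Prod>j\<in>I - {i}. x j ^ \<alpha> j)))"
      unfolding split by (auto intro!: ext)
    moreover have "?f' x = c * (real (\<alpha> i) * x i ^ (\<alpha> i - 1) * (\<Prod>j\<in>I - {i}. x j ^ \<alpha> j))"
      unfolding split by (auto simp: \<beta>_def)
    ultimately show ?thesis
      by (auto intro!: derivative_eq_intros)
  qed
  ultimately show ?case by (intro bexI[of _ ?f']) auto
next
  case (add f g)
  then obtain f' g' where
    "f' \<in> poly_funs I (D - 1)" "\<forall>x. ((\<lambda>t. f (x(i := t))) has_real_derivative f' x) (at (x i))"
    "g' \<in> poly_funs I (D - 1)" "\<forall>x. ((\<lambda>t. g (x(i := t))) has_real_derivative g' x) (at (x i))"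
    by blast
  then show ?case
    by (intro bexI[of _ "\<lambda>x. f' x + g' x"]) (auto simp del: fun_upd_apply intro!: DERIV_add poly_funs.add)
qed

section \<open>Linear algebra and the number of common zeros\<close>

lemma homogeneous_system_nontrivial_solution:
  fixes b :: "'b \<Rightarrow> 'a \<Rightarrow> real"
  assumes "finite B" "finite Z" "card B < card Z"
  shows "\<exists>c. (\<exists>z\<in>Z. c z \<noteq> 0) \<and> (\<forall>k\<in>B. (\<Sum>z\<in>Z. c z * b k z) = 0)"
  using assms
proof (induction B arbitrary: Z b rule: finite_induct)
  case empty
  then have "Z \<noteq> {}" by auto
  then show ?case by (intro exI[of _ "\<lambda>_. 1"]) auto
next
  case (insert k B)
  show ?case
  proof (cases "\<forall>z\<in>Z. b k z = 0")
    case True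
    obtain c where "\<exists>z\<in>Z. c z \<noteq> 0" "\<forall>k\<in>B. (\<Sum>z\<in>Z. c z * b k z) = 0"
      using insert.IH[of Z b] insert.prems insert.hyps by auto
    then show ?thesis using True by (intro exI[of _ c]) auto
  next
    case False
    then obtain z0 where z0: "z0 \<in> Z" "b k z0 \<noteq> 0" by blast
    let ?Z = "Z - {z0}"
    \<comment> \<open>Gaussian elimination: subtracting a multiple of equation \<open>k\<close>
      clears the unknown \<open>z0\<close> from equation \<open>l\<close>.\<close>
    define b' where "b' l z = b l z - b l z0 * b k z / b k z0" for l z
    obtain c where c: "\<exists>z\<in>?Z. c z \<noteq> 0" "\<forall>l\<in>B. (\<Sum>z\<in>?Z. c z * b' l z) = 0"
      using insert.IH[of ?Z b'] insert.prems insert.hyps z0 by (auto simp: less_diff_conv)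
    \<comment> \<open>Back substitution: the value at \<open>z0\<close> is the one that solves
      equation \<open>k\<close>.\<close>
    define e where "e = c(z0 := - (\<Sum>z\<in>?Z. c z * b k z) / b k z0)"
    have split: "(\<Sum>z\<in>Z. e z * b l z) =
        (\<Sum>z\<in>?Z. c z * b l z) - (\<Sum>z\<in>?Z. c z * b k z) / b k z0 * b l z0" for l
    proof -
      have "(\<Sum>z\<in>Z. e z * b l z) = e z0 * b l z0 + (\<Sum>z\<in>?Z. e z * b l z)"
        using z0 insert.prems by (simp add: sum.remove)
      also have "(\<Sum>z\<in>?Z. e z * b l z) = (\<Sum>z\<in>?Z. c z * b l z)"
        by (intro sum.cong) (auto simp: e_def)
      finally show ?thesis by (simp add: e_def)
    qed
    have "(\<Sum>z\<in>Z. e z * b l z) = (\<Sum>z\<in>?Z. c z * b' l z)" for l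
    proof -
      have "(\<Sum>z\<in>?Z. c z * b k z) / b k z0 * b l z0 = (\<Sum>z\<in>?Z. c z * (b l z0 * b k z / b k z0))"
        by (simp add: sum_distrib_left sum_divide_distrib mult_ac)
      then show ?thesis unfolding split b'_def by (simp add: right_diff_distrib sum_subtractf)
    qed
    moreover have "(\<Sum>z\<in>Z. e z * b k z) = 0" unfolding split using z0 by simp
    moreover have "\<exists>z\<in>Z. e z \<noteq> 0" using c(1) by (auto simp: e_def)
    ultimately show ?thesis using c(2) by (intro exI[of _ e]) auto
  qed
qed

text \<open>A substitute for Bezout's theorem: on \<open>Z\<close> every monomial with an exponent \<open>\<ge> N\<close> equals a
  polynomial of smaller total degree, so the reduced monomials, of which there are
  \<open>N ^ card I\<close>, span all polynomial functions on \<open>Z\<close>.\<close>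

lemma card_common_zeros_le:
  fixes Z :: "('i \<Rightarrow> real) set"
  assumes I: "finite I" and Z: "finite Z" and N: "N \<ge> 1"
    and g: "\<And>i. i \<in> I \<Longrightarrow> g i \<in> poly_funs I (N - 1)"
    and zero: "\<And>z i. z \<in> Z \<Longrightarrow> i \<in> I \<Longrightarrow> z i ^ N = g i z"
    and sep: "\<And>z z'. z \<in> Z \<Longrightarrow> z' \<in> Z \<Longrightarrow> (\<And>i. i \<in> I \<Longrightarrow> z i = z' i) \<Longrightarrow> z = z'"
  shows "card Z \<le> N ^ card I"
proof (rule ccontr)
  assume card_Z: "\<not> card Z \<le> N ^ card I"
  define B where "B = PiE I (\<lambda>_. {..<N})"
  have "card B < card Z" "finite B"
    using card_Z I by (auto simp: B_def card_PiE intro!: finite_PiE)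
  then obtain c where c: "\<exists>z\<in>Z. c z \<noteq> 0"
    "\<And>\<beta>. \<beta> \<in> B \<Longrightarrow> (\<Sum>z\<in>Z. c z * (\<Prod>i\<in>I. z i ^ \<beta> i)) = 0"
    using homogeneous_system_nontrivial_solution[OF _ Z, of B "\<lambda>\<beta> z. \<Prod>i\<in>I. z i ^ \<beta> i"] by blast
  \<comment> \<open>The coefficients \<open>c\<close> define a linear functional on functions on
    \<open>Z\<close> that kills the reduced monomials. In any other monomial, replacing a factor
    \<open>z i ^ N\<close> by \<open>g i z\<close> lowers the degree bound from \<open>D\<close> to
    at most \<open>D - 1\<close>, so induction shows that it kills all polynomials.\<close>
  have vanish: "(\<Sum>z\<in>Z. c z * f z) = 0" if "f \<in> poly_funs I D" for f D
    using that
  proof (induction D arbitrary: f rule: less_induct)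
    case (less D)
    from less.prems show ?case
    proof induction
      case (monomial \<alpha> a)
      show ?case
      proof (cases "\<forall>i\<in>I. \<alpha> i < N")
        case True
        then have "restrict \<alpha> I \<in> B" by (auto simp: B_def)
        moreover have "(\<Prod>i\<in>I. z i ^ restrict \<alpha> I i) = (\<Prod>i\<in>I. z i ^ \<alpha> i)" for z :: "_ \<Rightarrow> real"
          by (intro prod.cong) auto
        ultimately have "a * (\<Sum>z\<in>Z. c z * (\<Prod>i\<in>I. z i ^ \<alpha> i)) = 0" using c(2) by fastforce
        then show ?thesis by (simp add: sum_distrib_left mult_ac)
      next
        case False
        then obtain i where i: "i \<in> I" "\<alpha> i \<ge> N" by force
        define \<beta> where "\<beta> = \<alpha>(i := \<alpha> i - N)"
        have "sum \<alpha> I = \<alpha> i + sum \<alpha> (I - {i})" "sum \<beta> I = \<alpha> i - N + sum \<alpha> (I - {i})"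
          using i I by (simp_all add: sum.remove \<beta>_def)
        then have \<beta>: "sum \<beta> I \<le> D - N" "D \<ge> N" using monomial i by auto
        have "(\<lambda>x. g i x * (a * (\<Prod>i\<in>I. x i ^ \<beta> i))) \<in> poly_funs I (N - 1 + (D - N))"
          using g i \<beta> by (intro poly_funs_mult poly_funs.monomial)
        then have "(\<Sum>z\<in>Z. c z * (g i z * (a * (\<Prod>i\<in>I. z i ^ \<beta> i)))) = 0"
          by (rule less.IH[rotated]) (use \<beta> N in auto)
        moreover have "g i z * (\<Prod>i\<in>I. z i ^ \<beta> i) = (\<Prod>i\<in>I. z i ^ \<alpha> i)" if "z \<in> Z" for z
        proof -
          have "(\<Prod>j\<in>I. z j ^ \<alpha> j) = z i ^ \<alpha> i * (\<Prod>j\<in>I - {i}. z j ^ \<alpha> j)"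
            "(\<Prod>j\<in>I. z j ^ \<beta> j) = z i ^ (\<alpha> i - N) * (\<Prod>j\<in>I - {i}. z j ^ \<alpha> j)"
            using i I by (simp_all add: prod.remove \<beta>_def)
          moreover have "z i ^ \<alpha> i = z i ^ N * z i ^ (\<alpha> i - N)"
            using i by (simp flip: power_add)
          ultimately show ?thesis using zero[OF that i(1)] by simp
        qed
        moreover have "(\<Sum>z\<in>Z. c z * (g i z * (a * (\<Prod>i\<in>I. z i ^ \<beta> i)))) =
            (\<Sum>z\<in>Z. c z * (a * (g i z * (\<Prod>i\<in>I. z i ^ \<beta> i))))"
          by (simp add: mult.left_commute)
        ultimately show ?thesis by simp
      qed
    next
      case (add f g)
      then show ?case by (simp add: distrib_left sum.distrib)
    qed
  qed
  obtain z0 where z0: "z0 \<in> Z" "c z0 \<noteq> 0" using c by blast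
  have "\<exists>i\<in>I. z i \<noteq> z0 i" if "z \<in> Z - {z0}" for z
    using sep[of z z0] that z0 by auto
  then obtain k where k: "\<And>z. z \<in> Z - {z0} \<Longrightarrow> k z \<in> I \<and> z (k z) \<noteq> z0 (k z)" by metis
  \<comment> \<open>This polynomial separates \<open>z0\<close> from the rest of \<open>Z\<close>:
    each factor vanishes at one other point, and none vanishes at \<open>z0\<close>. Applied to it,
    the functional returns a nonzero multiple of \<open>c z0\<close>.\<close>
  let ?f = "\<lambda>x. \<Prod>z\<in>Z - {z0}. x (k z) - z (k z)"
  have "?f \<in> poly_funs I (card (Z - {z0}) * 1)"
    using k I by (intro poly_funs_prod poly_funs_diff poly_funs_var poly_funs_const) auto
  then have "(\<Sum>z\<in>Z. c z * ?f z) = 0" by (rule vanish)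
  moreover have "(\<Sum>z\<in>Z. c z * ?f z) = c z0 * ?f z0 + (\<Sum>z\<in>Z - {z0}. c z * ?f z)"
    using z0 Z by (simp add: sum.remove)
  moreover have "(\<Sum>z\<in>Z - {z0}. c z * ?f z) = 0"
    using Z by (intro sum.neutral ballI) auto
  moreover have "?f z0 \<noteq> 0" unfolding prod_zero_iff[OF finite_Diff[OF Z]] using k by fastforce
  ultimately show False using z0 by simp
qed

section \<open>Sign patterns of polynomials\<close>

lemma poly_funs_cong_vars:
  assumes "f \<in> poly_funs I D" "\<And>i. i \<in> I \<Longrightarrow> x i = y i"
  shows "f x = f y"
  using assms by induction auto

lemma finite_pos_lower_bound:
  fixes f :: "'a \<Rightarrow> real"
  assumes "finite S" "\<And>s. s \<in> S \<Longrightarrow> f s > 0"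
  shows "\<exists>h>0. \<forall>s\<in>S. h \<le> f s"
proof (cases "S = {}")
  case True
  then show ?thesis by (auto intro: exI[of _ 1])
next
  case False
  then show ?thesis using assms by (intro exI[of _ "Min (f ` S)"]) auto
qed

text \<open>Tychonoff's theorem. The coordinates outside \<open>I\<close> are pinned to 0, since
  leaving them free would destroy compactness.\<close>

lemma compact_box_fun:
  fixes R :: real
  shows "compact {x :: 'i \<Rightarrow> real. \<forall>i. if i \<in> I then \<bar>x i\<bar> \<le> R else x i = 0}"
proof -
  have "compactin (product_topology (\<lambda>_. euclidean) UNIV)
      (PiE UNIV (\<lambda>i :: 'i. if i \<in> I then {-R..R} else {0}))"
    by (simp add: compactin_PiE)
  moreover have "PiE UNIV (\<lambda>i :: 'i. if i \<in> I then {-R..R} else {0}) =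
      {x. \<forall>i. if i \<in> I then \<bar>x i\<bar> \<le> R else x i = 0}"
  proof -
    have "x i \<in> (if i \<in> I then {-R..R} else {0}) \<longleftrightarrow> (if i \<in> I then \<bar>x i\<bar> \<le> R else x i = 0)"
      for x :: "'i \<Rightarrow> real" and i by auto
    then show ?thesis by (simp add: PiE_def Pi_def)
  qed
  ultimately show ?thesis by (simp only: euclidean_product_topology compactin_euclidean_iff)
qed

lemma isCont_poly_funs_update:
  assumes "f \<in> poly_funs I D" "finite I" "i \<in> I"
  shows "isCont (\<lambda>t. f (x(i := t))) (x i)"
  using poly_funs_partial_derivative[OF assms] DERIV_isCont by blast

text \<open>If \<open>R - \<Sum>i\<in>I. (x i)\<^sup>2\<close> and all \<open>f j\<close> are nonzero at a sample point, then the product \<open>H\<close> of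
  the former with the squares of the latter vanishes on the boundary of the sample's cell.
  Hence the small perturbation \<open>H + \<epsilon> \<Sum>i\<in>I. x i ^ (N + 1)\<close> has a maximum inside the cell. The
  perturbation puts the critical point equations in the form required by
  \<open>card_common_zeros_le\<close>.\<close>

lemma card_strict_sign_samples_le:
  fixes S :: "('i \<Rightarrow> real) set" and f :: "'j \<Rightarrow> ('i \<Rightarrow> real) \<Rightarrow> real"
  assumes I: "finite I" and J: "finite J" and f: "\<And>j. j \<in> J \<Longrightarrow> f j \<in> poly_funs I D"
    and S: "finite S" and nz: "\<And>s j. s \<in> S \<Longrightarrow> j \<in> J \<Longrightarrow> f j s \<noteq> 0"
    and dist: "\<And>s s'. s \<in> S \<Longrightarrow> s' \<in> S \<Longrightarrow> (\<And>j. j \<in> J \<Longrightarrow> sgn (f j s) = sgn (f j s')) \<Longrightarrow> s = s'"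
  shows "card S \<le> (2 * card J * D + 2) ^ card I"
proof -
  define Q :: "('i \<Rightarrow> real) \<Rightarrow> real" where "Q x = (\<Sum>i\<in>I. x i ^ 2)" for x
  \<comment> \<open>The ball has all samples strictly inside, and \<open>R \<ge> 1\<close> turns
    \<open>(x i)\<^sup>2 \<le> R\<close> into \<open>\<bar>x i\<bar> \<le> R\<close>.\<close>
  define R where "R = 1 + (\<Sum>s\<in>S. Q s)"
  \<comment> \<open>The degree of \<open>H\<close>: 2 from \<open>R - Q x\<close> and
    \<open>2 * D\<close> from each squared factor.\<close>
  define N where "N = 2 * card J * D + 2"
  have Q_ge: "x i ^ 2 \<le> Q x" if "i \<in> I" for x i
    unfolding Q_def using that I by (intro member_le_sum) auto
  have Q0: "Q x \<ge> 0" for x unfolding Q_def by (intro sum_nonneg) auto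
  have R1: "R \<ge> 1" unfolding R_def using Q0 by (simp add: sum_nonneg)
  have QR: "Q s < R" if "s \<in> S" for s
    using member_le_sum[of s S Q] that S Q0 by (auto simp: R_def)
  have bound: "\<bar>x i\<bar> \<le> R" if "Q x \<le> R" "i \<in> I" for x i
  proof -
    have "\<bar>x i\<bar> ^ 2 \<le> R ^ 2"
      using Q_ge[OF that(2), of x] that(1) R1 by (simp add: power2_eq_square) (smt (verit) mult_left_le_one_le mult_le_cancel_left1)
    then show ?thesis using R1 abs_le_square_iff[of "x i" R] by simp
  qed
  have Qpoly: "Q \<in> poly_funs I 2"
    unfolding Q_def
    using poly_funs_power[OF poly_funs_var[OF _ I, of _ 1], of _ 2]
    by (intro poly_funs_sum) simp
  define H where "H x = (R - Q x) * (\<Prod>j\<in>J. f j x ^ 2)" for x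
  have "H \<in> poly_funs I (2 + card J * (2 * D))"
    unfolding H_def
    using Qpoly f by (intro poly_funs_mult poly_funs_diff poly_funs_const poly_funs_prod poly_funs_power) auto
  then have Hpoly: "H \<in> poly_funs I N" by (simp add: N_def mult_ac add.commute)
  then have "\<exists>H'. \<forall>i\<in>I. H' i \<in> poly_funs I (N - 1) \<and>
      (\<forall>x. ((\<lambda>t. H (x(i := t))) has_real_derivative H' i x) (at (x i)))"
    using poly_funs_partial_derivative[OF Hpoly I] by metis
  then obtain H' where H': "\<And>i. i \<in> I \<Longrightarrow> H' i \<in> poly_funs I (N - 1)"
    "\<And>i x. i \<in> I \<Longrightarrow> ((\<lambda>t. H (x(i := t))) has_real_derivative H' i x) (at (x i))"
    by blast
  have "H s > 0" if "s \<in> S" for s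
    unfolding H_def using QR nz that J by (intro mult_pos_pos prod_pos) auto
  then obtain h where h: "h > 0" "\<And>s. s \<in> S \<Longrightarrow> h \<le> H s"
    using finite_pos_lower_bound[OF S] by metis
  define M where "M = real (card I) * R ^ (N + 1)"
  have M: "M \<ge> 0" using R1 by (simp add: M_def)
  \<comment> \<open>Small enough that the perturbation, bounded by \<open>\<epsilon> * M\<close> on
    the ball, cannot use up the gap \<open>h\<close>: a maximiser \<open>x\<close> of
    \<open>G\<close> has \<open>H x \<ge> h - 2 * (\<epsilon> * M) > 0\<close>.\<close>
  define \<epsilon> where "\<epsilon> = h / (2 * M + 1)"
  have \<epsilon>: "\<epsilon> > 0" "2 * (\<epsilon> * M) < h"
    using h M by (auto simp: \<epsilon>_def field_simps)
  define V :: "('i \<Rightarrow> real) \<Rightarrow> real" where "V x = (\<Sum>i\<in>I. x i ^ (N + 1))" for x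
  have V: "\<bar>V x\<bar> \<le> M" if "Q x \<le> R" for x
  proof -
    have "\<bar>V x\<bar> \<le> (\<Sum>i\<in>I. \<bar>x i ^ (N + 1)\<bar>)" unfolding V_def by (rule sum_abs)
    also have "\<dots> \<le> (\<Sum>i\<in>I. R ^ (N + 1))"
      unfolding power_abs using bound[OF that] by (intro sum_mono power_mono) auto
    finally show ?thesis by (simp add: M_def)
  qed
  define G where "G x = H x + \<epsilon> * V x" for x
  have Gcont: "continuous_on A G" for A
  proof -
    have "V \<in> poly_funs I (N + 1)"
      unfolding V_def
      using poly_funs_power[OF poly_funs_var[OF _ I, of _ 1], of _ "N + 1"]
      by (intro poly_funs_sum) simp
    then have "G \<in> poly_funs I (N + 1)"
      unfolding G_def using poly_funs_mono_degree[OF Hpoly] by (intro poly_funs.add poly_funs_cmult) auto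
    then show ?thesis by (rule continuous_on_poly_funs)
  qed
  define g where "g i x = - 1 / (\<epsilon> * (N + 1)) * H' i x" for i x
  have crit: "\<exists>x. (\<forall>i. i \<notin> I \<longrightarrow> x i = 0) \<and> (\<forall>j\<in>J. sgn (f j x) = sgn (f j s)) \<and>
      (\<forall>i\<in>I. x i ^ N = g i x)" if s: "s \<in> S" for s
  proof -
    \<comment> \<open>The cell of \<open>s\<close> with weak inequalities, so that it is compact.
      Strictness at the maximiser is recovered from \<open>H x > 0\<close>, as \<open>H\<close>
      vanishes wherever one of the sign or ball inequalities is an equality.\<close>
    define C where "C = {x. \<forall>i. if i \<in> I then \<bar>x i\<bar> \<le> R else x i = 0} \<inter>
      ({x. Q x \<le> R} \<inter> (\<Inter>j\<in>J. {x. 0 \<le> sgn (f j s) * f j x}))"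
    have Q_closed: "closed {x. Q x \<le> R}"
      by (intro closed_Collect_le continuous_on_poly_funs[OF Qpoly] continuous_on_const)
    have f_closed: "closed {x. 0 \<le> sgn (f j s) * f j x}" if "j \<in> J" for j
      by (intro closed_Collect_le continuous_on_const continuous_on_mult_left
          continuous_on_poly_funs[OF f[OF that]])
    have "compact C"
      unfolding C_def
      by (rule compact_Int_closed[OF compact_box_fun closed_Int[OF Q_closed closed_INT]])
        (use f_closed in blast)
    \<comment> \<open>The sample with its coordinates outside \<open>I\<close> set to 0, so that it
      lies in \<open>C\<close>; the polynomials cannot tell the difference.\<close>
    define r where "r i = (if i \<in> I then s i else 0)" for i
    have fr: "f j r = f j s" if "j \<in> J" for j
      by (rule poly_funs_cong_vars[OF f[OF that]]) (simp add: r_def)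
    have Qr: "Q r = Q s" "H r = H s"
      by (rule poly_funs_cong_vars[OF Qpoly] poly_funs_cong_vars[OF Hpoly], simp add: r_def)+
    have "\<bar>r i\<bar> \<le> R" if "i \<in> I" for i
      using bound[of r, OF _ that] Qr QR[OF s] by simp
    then have rC: "r \<in> C"
      using Qr QR[OF s] fr by (auto simp: C_def sgn_if r_def)
    obtain x where x: "x \<in> C" "\<And>y. y \<in> C \<Longrightarrow> G y \<le> G x"
      using continuous_attains_sup[OF \<open>compact C\<close> _ Gcont] rC by blast
    have xQ: "Q x \<le> R" and xf: "\<And>j. j \<in> J \<Longrightarrow> 0 \<le> sgn (f j s) * f j x"
      and x0: "\<And>i. i \<notin> I \<Longrightarrow> x i = 0"
      using x(1) by (auto simp: C_def split: if_splits)
    have "G r \<le> G x" using x(2) rC by blast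
    moreover have "\<epsilon> * \<bar>V r\<bar> \<le> \<epsilon> * M" "\<epsilon> * \<bar>V x\<bar> \<le> \<epsilon> * M"
      using V[of r] V[OF xQ] Qr QR[OF s] \<epsilon> by auto
    moreover have "\<bar>\<epsilon> * V r\<bar> = \<epsilon> * \<bar>V r\<bar>" "\<bar>\<epsilon> * V x\<bar> = \<epsilon> * \<bar>V x\<bar>"
      using \<epsilon> by (auto simp: abs_mult)
    ultimately have "H x > 0"
      using h(2)[OF s] \<epsilon>(2) Qr unfolding G_def by linarith
    then have "R - Q x \<noteq> 0" "(\<Prod>j\<in>J. f j x ^ 2) \<noteq> 0" unfolding H_def by force+
    then have "Q x \<noteq> R" "\<And>j. j \<in> J \<Longrightarrow> f j x \<noteq> 0"
      using J by auto
    then have xR: "Q x < R" and xs: "\<And>j. j \<in> J \<Longrightarrow> 0 < sgn (f j s) * f j x"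
      using xQ xf nz[OF s] by (force simp: less_le sgn_if)+
    have "sgn (f j x) = sgn (f j s)" if "j \<in> J" for j
      using xs[OF that] nz[OF s that] by (auto simp: sgn_if split: if_splits)
    moreover have "x i ^ N = g i x" if i: "i \<in> I" for i
    proof -
      \<comment> \<open>Strict inequalities survive small changes of one coordinate, so
        \<open>x\<close> is a local maximum along every coordinate line.\<close>
      have "eventually (\<lambda>t. Q (x(i := t)) < R) (at (x i))"
        using isCont_poly_funs_update[OF Qpoly I i, of x] xR
        by (intro order_tendstoD(2)) (auto simp: isCont_def)
      moreover have "eventually (\<lambda>t. 0 < sgn (f j s) * f j (x(i := t))) (at (x i))" if j: "j \<in> J" for j
      proof -
        have "isCont (\<lambda>t. sgn (f j s) * f j (x(i := t))) (x i)"
          by (intro continuous_intros isCont_poly_funs_update[OF f[OF j] I i])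
        then show ?thesis using xs[OF j]
          by (intro order_tendstoD(1)) (auto simp: isCont_def)
      qed
      ultimately have "eventually (\<lambda>t. Q (x(i := t)) < R \<and>
          (\<forall>j\<in>J. 0 < sgn (f j s) * f j (x(i := t)))) (at (x i))"
        using J by (intro eventually_conj eventually_ball_finite) auto
      then obtain d where d: "d > 0" "\<And>t. t \<noteq> x i \<Longrightarrow> dist t (x i) < d \<Longrightarrow>
          Q (x(i := t)) < R \<and> (\<forall>j\<in>J. 0 < sgn (f j s) * f j (x(i := t)))"
        unfolding eventually_at by auto
      have "G (x(i := t)) \<le> G (x(i := x i))" if "\<bar>x i - t\<bar> < d" for t
      proof (cases "t = x i")
        case False
        then have t: "Q (x(i := t)) < R" "\<forall>j\<in>J. 0 < sgn (f j s) * f j (x(i := t))"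
          using d(2) that by (auto simp: dist_real_def abs_minus_commute)
        then have "x(i := t) \<in> C"
          using bound[of "x(i := t)"] x0 i unfolding C_def by (auto intro: less_imp_le)
        then show ?thesis using x(2) by simp
      qed simp
      moreover have "((\<lambda>t. G (x(i := t))) has_real_derivative
          H' i x + \<epsilon> * (real (N + 1) * x i ^ N)) (at (x i))"
      proof -
        have "(\<lambda>t. V (x(i := t))) = (\<lambda>t. t ^ (N + 1) + (\<Sum>k\<in>I - {i}. x k ^ (N + 1)))"
        proof
          fix t
          have "V (x(i := t)) = t ^ (N + 1) + (\<Sum>k\<in>I - {i}. (x(i := t)) k ^ (N + 1))"
            unfolding V_def using sum.remove[OF I i, of "\<lambda>k. (x(i := t)) k ^ (N + 1)"] by simp
          also have "(\<Sum>k\<in>I - {i}. (x(i := t)) k ^ (N + 1)) = (\<Sum>k\<in>I - {i}. x k ^ (N + 1))"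
            by (intro sum.cong) auto
          finally show "V (x(i := t)) = t ^ (N + 1) + (\<Sum>k\<in>I - {i}. x k ^ (N + 1))" .
        qed
        then have "((\<lambda>t. V (x(i := t))) has_real_derivative real (N + 1) * x i ^ N) (at (x i))"
          using DERIV_add[OF DERIV_pow[of "N + 1" "x i"] DERIV_const] by simp
        then show ?thesis
          unfolding G_def using H'(2)[OF i, of x] by (intro DERIV_add DERIV_cmult)
      qed
      ultimately have "H' i x + \<epsilon> * (real (N + 1) * x i ^ N) = 0"
        using DERIV_local_max[of "\<lambda>t. G (x(i := t))" _ "x i" d] d(1) by blast
      then have "x i ^ N * (\<epsilon> * real (N + 1)) = - H' i x"
        by (metis add.commute eq_neg_iff_add_eq_0 mult.assoc mult.commute)
      moreover have "\<epsilon> * real (N + 1) \<noteq> 0" using \<epsilon>(1) by simp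
      ultimately have "x i ^ N = - H' i x / (\<epsilon> * real (N + 1))"
        by (intro eq_divide_imp)
      then show ?thesis by (simp add: g_def)
    qed
    ultimately show ?thesis using x0 by blast
  qed
  then obtain \<xi> where \<xi>: "\<And>s i. s \<in> S \<Longrightarrow> i \<notin> I \<Longrightarrow> \<xi> s i = 0"
    "\<And>s j. s \<in> S \<Longrightarrow> j \<in> J \<Longrightarrow> sgn (f j (\<xi> s)) = sgn (f j s)"
    "\<And>s i. s \<in> S \<Longrightarrow> i \<in> I \<Longrightarrow> \<xi> s i ^ N = g i (\<xi> s)"
    by metis
  \<comment> \<open>Each critical point has the sign pattern of its sample, and distinct samples
    have distinct patterns.\<close>
  have "inj_on \<xi> S"
    using \<xi>(2) dist by (intro inj_onI) metis
  then have "card S = card (\<xi> ` S)" by (simp add: card_image)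
  also have "\<dots> \<le> N ^ card I"
  proof (rule card_common_zeros_le[OF I])
    show "g i \<in> poly_funs I (N - 1)" if "i \<in> I" for i
      unfolding g_def using H'(1)[OF that] by (rule poly_funs_cmult)
    show "z = z'" if "z \<in> \<xi> ` S" "z' \<in> \<xi> ` S" "\<And>i. i \<in> I \<Longrightarrow> z i = z' i" for z z'
    proof
      fix i show "z i = z' i" using that \<xi>(1) by (cases "i \<in> I") auto
    qed
  qed (use S \<xi>(3) in \<open>auto simp: N_def\<close>)
  finally show ?thesis by (simp add: N_def)
qed

text \<open>One sample per realised pattern reduces the claim to counting points. Each polynomial is
  replaced by two shifted copies that are nonzero at all samples; this doubling turns the 2 of the
  strict bound into 4.\<close>

lemma sign_pattern_cover:
  fixes F :: "(('i \<Rightarrow> real) \<Rightarrow> real) set"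
  assumes I: "finite I" and F: "finite F" "F \<subseteq> poly_funs I D"
  shows "\<exists>\<S>. finite \<S> \<and> \<Union>\<S> = UNIV \<and> card \<S> \<le> (4 * card F * D + 2) ^ card I \<and>
    (\<forall>S\<in>\<S>. \<forall>x\<in>S. \<forall>y\<in>S. \<forall>f\<in>F. sgn (f x) = sgn (f y))"
proof -
  define pat where "pat x = restrict (\<lambda>f. sgn (f x)) F" for x :: "'i \<Rightarrow> real"
  have pat_eq: "pat x = pat y \<longleftrightarrow> (\<forall>f\<in>F. sgn (f x) = sgn (f y))" for x y
    by (auto simp: pat_def restrict_def fun_eq_iff)
  have "range pat \<subseteq> PiE F (\<lambda>_. {-1, 0, 1})"
    by (auto simp: pat_def sgn_if split: if_splits)
  then have fin: "finite (range pat)"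
    by (rule finite_subset) (simp add: F(1) finite_PiE)
  define T where "T = inv_into UNIV pat ` range pat"
  have T: "finite T" "card T = card (range pat)"
    using fin by (auto simp: T_def intro!: card_image inj_on_inv_into)
  have T_dist: "s = s'" if "s \<in> T" "s' \<in> T" "pat s = pat s'" for s s'
    using that by (auto simp: T_def f_inv_into_f)
  define V where "V = {q \<in> T \<times> F. snd q (fst q) \<noteq> 0}"
  have "finite V" unfolding V_def using T(1) F(1) by simp
  then have "\<exists>e>0. \<forall>q\<in>V. e \<le> \<bar>snd q (fst q)\<bar>"
    by (rule finite_pos_lower_bound) (simp add: V_def)
  then obtain e where e0: "e > 0" "\<And>q. q \<in> V \<Longrightarrow> e \<le> \<bar>snd q (fst q)\<bar>" by blast
  have e: "e > 0" "\<And>s f. s \<in> T \<Longrightarrow> f \<in> F \<Longrightarrow> f s \<noteq> 0 \<Longrightarrow> e \<le> \<bar>f s\<bar>"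
    using e0(1) e0(2)[of "(s, f)" for s f] by (simp_all add: V_def)
  \<comment> \<open>Shifting by \<open>\<plusminus> e / 2\<close> turns the three signs of \<open>f\<close> at the sample points into strict ones.\<close>
  define f' where "f' = (\<lambda>(f, b) (x :: 'i \<Rightarrow> real). f x - (if b then e / 2 else - e / 2))"
  have "card T \<le> (2 * card (F \<times> (UNIV :: bool set)) * D + 2) ^ card I"
  proof (rule card_strict_sign_samples_le[where f = f'])
    show "f' j \<in> poly_funs I D" if "j \<in> F \<times> UNIV" for j
      using that F(2) by (auto simp: f'_def intro!: poly_funs_diff poly_funs_const)
    show "f' j s \<noteq> 0" if "s \<in> T" "j \<in> F \<times> UNIV" for s j
      using e(1) e(2)[OF that(1), of "fst j"] that(2) by (cases "fst j s = 0") (auto simp: f'_def split: if_splits)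
    show "s = s'" if s: "s \<in> T" "s' \<in> T" "\<And>j. j \<in> F \<times> UNIV \<Longrightarrow> sgn (f' j s) = sgn (f' j s')" for s s'
    proof -
      have "sgn (f s) = sgn (f s')" if "f \<in> F" for f
        using s(3)[of "(f, True)"] s(3)[of "(f, False)"] that e(1) e(2)[OF s(1) that] e(2)[OF s(2) that]
        unfolding f'_def
        by (cases "f s = 0"; cases "f s' = 0") (auto simp: sgn_if split: if_splits)
      then show ?thesis using T_dist s pat_eq by blast
    qed
  qed (use I F T in auto)
  then have card: "card (range pat) \<le> (4 * card F * D + 2) ^ card I"
    by (simp add: T(2) card_cartesian_product mult_ac)
  define \<S> where "\<S> = (\<lambda>p. {x. pat x = p}) ` range pat"
  have "card \<S> \<le> card (range pat)" unfolding \<S>_def by (rule card_image_le[OF fin])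
  then have "card \<S> \<le> (4 * card F * D + 2) ^ card I" using card by linarith
  moreover have "finite \<S>" "\<Union>\<S> = UNIV" unfolding \<S>_def using fin by auto
  moreover have "\<forall>S\<in>\<S>. \<forall>x\<in>S. \<forall>y\<in>S. \<forall>f\<in>F. sgn (f x) = sgn (f y)"
  proof (intro ballI)
    fix S x y f assume "S \<in> \<S>" "x \<in> S" "y \<in> S" "f \<in> F"
    then have "pat x = pat y" by (auto simp: \<S>_def)
    then show "sgn (f x) = sgn (f y)" using \<open>f \<in> F\<close> pat_eq by simp
  qed
  ultimately show ?thesis by blast
qed

section \<open>Functions that are polynomial on the cells of a cover\<close>

text \<open>If \<open>x\<close> lies in the interval and \<open>y\<close> does not, then an endpoint
  lies weakly between them. Comparing signs, including the sign 0, with this endpoint tells them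
  apart, whether or not the interval contains it.\<close>

lemma is_interval_1_sgn_determined:
  fixes J :: "real set"
  assumes "is_interval J"
  shows "\<exists>T. finite T \<and> card T \<le> 2 \<and>
    (\<forall>x y. (\<forall>b\<in>T. sgn (x - b) = sgn (y - b)) \<longrightarrow> x \<in> J \<longrightarrow> y \<in> J)"
proof -
  define T where "T = (if bdd_below J then {Inf J} else {}) \<union> (if bdd_above J then {Sup J} else {})"
  have "card T \<le> 2" "finite T" by (auto simp: T_def card_insert_if)
  moreover have "y \<in> J" if T: "\<forall>b\<in>T. sgn (x - b) = sgn (y - b)" and x: "x \<in> J" for x y
  proof (rule ccontr)
    assume y: "y \<notin> J"
    have conv: "c \<in> J" if "a \<in> J" "b \<in> J" "a \<le> c" "c \<le> b" for a b c
      using assms that unfolding is_interval_1 by blast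
    show False
    proof (cases "x < y")
      case True
      have up: "z \<le> y" if "z \<in> J" for z
        using conv[OF x that, of y] True y by force
      then have bdd: "bdd_above J" by (intro bdd_aboveI)
      have "x \<le> Sup J" using x bdd by (rule cSup_upper)
      moreover have "Sup J \<le> y" using x up by (intro cSup_least) auto
      moreover have "sgn (x - Sup J) = sgn (y - Sup J)" using T bdd by (simp add: T_def)
      ultimately show False using True by (auto simp: sgn_if split: if_splits)
    next
      case False
      then have "y < x" using x y by (cases "x = y") auto
      have lo: "y \<le> z" if "z \<in> J" for z
        using conv[OF that x, of y] \<open>y < x\<close> y by force
      then have bdd: "bdd_below J" by (intro bdd_belowI)
      have "Inf J \<le> x" using x bdd by (rule cInf_lower)
      moreover have "y \<le> Inf J" using x lo by (intro cInf_greatest) auto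
      moreover have "sgn (x - Inf J) = sgn (y - Inf J)" using T bdd by (simp add: T_def)
      ultimately show False using \<open>y < x\<close> by (auto simp: sgn_if split: if_splits)
    qed
  qed
  ultimately show ?thesis by blast
qed

text \<open>Two endpoints per piece give \<open>2 * p\<close>. The set \<open>Y\<close> will be the
  range of a preactivation on one cell: if no breakpoint separates its points, a single polynomial
  describes \<sigma> there.\<close>

lemma piecewise_polynomial_breakpoints:
  assumes "piecewise_polynomial p \<delta> \<sigma>"
  shows "\<exists>T. finite T \<and> card T \<le> 2 * p \<and>
    (\<forall>Y. (\<forall>x\<in>Y. \<forall>y\<in>Y. \<forall>b\<in>T. sgn (x - b) = sgn (y - b)) \<longrightarrow>
      (\<exists>q. degree q \<le> \<delta> \<and> (\<forall>x\<in>Y. \<sigma> x = poly q x)))"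
proof -
  obtain \<I> where \<I>: "partition_on UNIV \<I>" "finite \<I>" "card \<I> = p"
    "\<And>J. J \<in> \<I> \<Longrightarrow> is_interval J"
    "\<And>J. J \<in> \<I> \<Longrightarrow> \<exists>q :: real poly. degree q \<le> \<delta> \<and> (\<forall>x\<in>J. \<sigma> x = poly q x)"
    using assms unfolding piecewise_polynomial_def by metis
  obtain T where T: "\<And>J. J \<in> \<I> \<Longrightarrow> finite (T J)" "\<And>J. J \<in> \<I> \<Longrightarrow> card (T J) \<le> 2"
    "\<And>J x y. J \<in> \<I> \<Longrightarrow> \<forall>b\<in>T J. sgn (x - b) = sgn (y - b) \<Longrightarrow> x \<in> J \<Longrightarrow> y \<in> J"
    using is_interval_1_sgn_determined[OF \<I>(4)] by metis
  have "card (\<Union>J\<in>\<I>. T J) \<le> (\<Sum>J\<in>\<I>. card (T J))" by (rule card_UN_le[OF \<I>(2)])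
  also have "\<dots> \<le> (\<Sum>J\<in>\<I>. 2)" using T(2) by (rule sum_mono)
  finally have "card (\<Union>J\<in>\<I>. T J) \<le> 2 * p" using \<I>(3) by simp
  moreover have "finite (\<Union>J\<in>\<I>. T J)" using \<I>(2) T(1) by blast
  moreover have "\<exists>q. degree q \<le> \<delta> \<and> (\<forall>x\<in>Y. \<sigma> x = poly q x)"
    if Y: "\<forall>x\<in>Y. \<forall>y\<in>Y. \<forall>b\<in>(\<Union>J\<in>\<I>. T J). sgn (x - b) = sgn (y - b)" for Y
  proof (cases "Y = {}")
    case True
    then show ?thesis by (intro exI[of _ 0]) simp
  next
    case False
    then obtain x where x: "x \<in> Y" by blast
    obtain J where J: "J \<in> \<I>" "x \<in> J"
      using partition_onD1[OF \<I>(1)] by blast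
    have "Y \<subseteq> J"
    proof
      fix y assume "y \<in> Y"
      then have "\<forall>b\<in>T J. sgn (x - b) = sgn (y - b)" using Y x J(1) by blast
      then show "y \<in> J" using T(3) J by blast
    qed
    then show ?thesis using \<I>(5)[OF J(1)] by blast
  qed
  ultimately show ?thesis by blast
qed

text \<open>The points of a cell are parameter records, whereas sign patterns are counted in
  coordinate space. The map \<open>co\<close> reads off coordinates, and only those in
  \<open>I\<close> enter the polynomial.\<close>

definition poly_on :: "('x \<Rightarrow> 'i \<Rightarrow> real) \<Rightarrow> 'x set \<Rightarrow> 'i set \<Rightarrow> nat \<Rightarrow> ('x \<Rightarrow> real) \<Rightarrow> bool" where
  "poly_on co C I D f \<longleftrightarrow> (\<exists>q\<in>poly_funs I D. \<forall>x\<in>C. f x = q (co x))"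

lemma poly_onI: "q \<in> poly_funs I D \<Longrightarrow> (\<And>x. x \<in> C \<Longrightarrow> f x = q (co x)) \<Longrightarrow> poly_on co C I D f"
  unfolding poly_on_def by blast

lemma poly_onE:
  assumes "poly_on co C I D f"
  obtains q where "q \<in> poly_funs I D" "\<And>x. x \<in> C \<Longrightarrow> f x = q (co x)"
  using assms unfolding poly_on_def by blast

lemma poly_on_const: "poly_on co C I D (\<lambda>x. c)"
  by (rule poly_onI[OF poly_funs_const]) simp

lemma poly_on_var:
  assumes "i \<in> I" "finite I" "1 \<le> D"
  shows "poly_on co C I D (\<lambda>x. co x i)"
  by (rule poly_onI[OF poly_funs_var[OF assms]]) simp

lemma poly_on_add:
  assumes "poly_on co C I D f" "poly_on co C I D g"
  shows "poly_on co C I D (\<lambda>x. f x + g x)"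
proof -
  obtain q r where "q \<in> poly_funs I D" "\<And>x. x \<in> C \<Longrightarrow> f x = q (co x)"
    "r \<in> poly_funs I D" "\<And>x. x \<in> C \<Longrightarrow> g x = r (co x)"
    using assms by (metis poly_onE)
  then show ?thesis by (intro poly_onI[OF poly_funs.add]) simp_all
qed

lemma poly_on_mult:
  assumes "poly_on co C I D f" "poly_on co C I E g"
  shows "poly_on co C I (D + E) (\<lambda>x. f x * g x)"
proof -
  obtain q r where "q \<in> poly_funs I D" "\<And>x. x \<in> C \<Longrightarrow> f x = q (co x)"
    "r \<in> poly_funs I E" "\<And>x. x \<in> C \<Longrightarrow> g x = r (co x)"
    using assms by (metis poly_onE)
  then show ?thesis by (intro poly_onI[OF poly_funs_mult]) simp_all
qed

lemma poly_on_sum: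
  assumes "\<And>a. a \<in> A \<Longrightarrow> poly_on co C I D (f a)"
  shows "poly_on co C I D (\<lambda>x. \<Sum>a\<in>A. f a x)"
  using assms
  by (induction A rule: infinite_finite_induct) (simp_all add: poly_on_const poly_on_add)

lemma poly_on_mono:
  assumes "poly_on co C I D f" "I \<subseteq> J" "finite J" "D \<le> E"
  shows "poly_on co C J E f"
proof -
  obtain q where "q \<in> poly_funs I D" "\<And>x. x \<in> C \<Longrightarrow> f x = q (co x)"
    using assms(1) unfolding poly_on_def by blast
  then show ?thesis
    using assms(2-) by (intro poly_onI[OF poly_funs_mono_degree[OF poly_funs_mono_vars]])
qed

lemma poly_on_cong:
  assumes "poly_on co C I D f" "\<And>x. x \<in> C \<Longrightarrow> g x = f x"
  shows "poly_on co C I D g"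
  using assms unfolding poly_on_def by simp

text \<open>A cover suffices in place of a partition, since only an upper bound on the number of
  cells is used. The polynomial may depend on both the cell and the index \<open>k\<close>, but one
  cover serves the whole family.\<close>

definition cellwise_poly ::
  "('x \<Rightarrow> 'i \<Rightarrow> real) \<Rightarrow> 'x set \<Rightarrow> nat \<Rightarrow> 'i set \<Rightarrow> nat \<Rightarrow> 'k set \<Rightarrow> ('k \<Rightarrow> 'x \<Rightarrow> real) \<Rightarrow> bool" where
  "cellwise_poly co X B I D K h \<longleftrightarrow>
     (\<exists>\<C>. finite \<C> \<and> \<Union>\<C> = X \<and> card \<C> \<le> B \<and> (\<forall>C\<in>\<C>. \<forall>k\<in>K. poly_on co C I D (h k)))"

text \<open>For steps that need no new cuts: forming preactivations, and passing from representative
  vertices to all vertices. The cover stays the same.\<close>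

lemma cellwise_poly_lift:
  assumes "cellwise_poly co X B I D K h" "B \<le> B'"
    and "\<And>C. C \<subseteq> X \<Longrightarrow> (\<And>k. k \<in> K \<Longrightarrow> poly_on co C I D (h k)) \<Longrightarrow>
      (\<And>k. k \<in> K' \<Longrightarrow> poly_on co C I' D' (h' k))"
  shows "cellwise_poly co X B' I' D' K' h'"
proof -
  obtain \<C> where \<C>: "finite \<C>" "\<Union>\<C> = X" "card \<C> \<le> B"
    "\<And>C k. C \<in> \<C> \<Longrightarrow> k \<in> K \<Longrightarrow> poly_on co C I D (h k)"
    using assms(1) unfolding cellwise_poly_def by blast
  have "poly_on co C I' D' (h' k)" if "C \<in> \<C>" "k \<in> K'" for C k
    using assms(3)[of C k] \<C> that by blast
  then show ?thesis using \<C> assms(2) unfolding cellwise_poly_def by (intro exI[of _ \<C>]) auto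
qed

lemma cover_refine:
  assumes "finite \<C>" "\<Union>\<C> = X"
    and "\<And>C. C \<in> \<C> \<Longrightarrow> \<exists>\<S>. finite \<S> \<and> \<Union>\<S> = UNIV \<and> card \<S> \<le> b \<and> (\<forall>S\<in>\<S>. Q (C \<inter> S))"
  shows "\<exists>\<D>. finite \<D> \<and> \<Union>\<D> = X \<and> card \<D> \<le> card \<C> * b \<and> (\<forall>D\<in>\<D>. Q D)"
proof -
  obtain \<S> where \<S>: "\<And>C. C \<in> \<C> \<Longrightarrow> finite (\<S> C)" "\<And>C. C \<in> \<C> \<Longrightarrow> \<Union>(\<S> C) = UNIV"
    "\<And>C. C \<in> \<C> \<Longrightarrow> card (\<S> C) \<le> b" "\<And>C S. C \<in> \<C> \<Longrightarrow> S \<in> \<S> C \<Longrightarrow> Q (C \<inter> S)"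
    using assms(3) by metis
  define \<D> where "\<D> = (\<Union>C\<in>\<C>. (\<inter>) C ` \<S> C)"
  have "card \<D> \<le> (\<Sum>C\<in>\<C>. card ((\<inter>) C ` \<S> C))"
    unfolding \<D>_def by (rule card_UN_le[OF assms(1)])
  also have "\<dots> \<le> (\<Sum>C\<in>\<C>. b)"
    using \<S> by (intro sum_mono le_trans[OF card_image_le]) auto
  finally have "card \<D> \<le> card \<C> * b" by simp
  moreover have "finite \<D>" using \<S>(1) assms(1) by (simp add: \<D>_def)
  moreover have "\<Union>\<D> = X"
  proof -
    have "\<Union>((\<inter>) C ` \<S> C) = C" if "C \<in> \<C>" for C
      using \<S>(2)[OF that] by blast
    then have "(\<Union>C\<in>\<C>. \<Union>((\<inter>) C ` \<S> C)) = \<Union>\<C>" by simp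
    moreover have "\<Union>\<D> = (\<Union>C\<in>\<C>. \<Union>((\<inter>) C ` \<S> C))" by (auto simp: \<D>_def)
    ultimately show ?thesis using assms(2) by simp
  qed
  moreover have "\<forall>D\<in>\<D>. Q D" using \<S>(4) by (auto simp: \<D>_def)
  ultimately show ?thesis by blast
qed

text \<open>On \<open>C\<close> the functions factor through \<open>co\<close>, so a sign cover of
  coordinate space can be pulled back along \<open>co\<close>. Signs are controlled only inside
  \<open>C\<close>.\<close>

lemma sign_cover_pullback:
  assumes I: "finite I" and K: "finite K" "card K \<le> m"
    and f: "\<And>k. k \<in> K \<Longrightarrow> poly_on co C I D (f k)"
  shows "\<exists>\<S>. finite \<S> \<and> \<Union>\<S> = UNIV \<and> card \<S> \<le> (4 * m * D + 2) ^ card I \<and>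
    (\<forall>S\<in>\<S>. \<forall>x\<in>C \<inter> S. \<forall>y\<in>C \<inter> S. \<forall>k\<in>K. sgn (f k x) = sgn (f k y))"
proof -
  obtain q where q: "\<And>k. k \<in> K \<Longrightarrow> q k \<in> poly_funs I D"
    "\<And>k x. k \<in> K \<Longrightarrow> x \<in> C \<Longrightarrow> f k x = q k (co x)"
    using f unfolding poly_on_def by metis
  have "finite (q ` K)" "q ` K \<subseteq> poly_funs I D" using K(1) q(1) by auto
  from sign_pattern_cover[OF I this] obtain \<S> where
    \<S>: "finite \<S>" "\<Union>\<S> = UNIV" "card \<S> \<le> (4 * card (q ` K) * D + 2) ^ card I"
    and sgn: "\<forall>S\<in>\<S>. \<forall>x\<in>S. \<forall>y\<in>S. \<forall>f\<in>q ` K. sgn (f x) = sgn (f y)"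
    by (elim exE conjE)
  have "card (q ` K) \<le> m" using card_image_le[OF K(1), of q] K(2) by simp
  then have "(4 * card (q ` K) * D + 2) ^ card I \<le> (4 * m * D + 2) ^ card I"
    by (intro power_mono add_right_mono mult_right_mono) auto
  moreover have "card ((-`) co ` \<S>) \<le> card \<S>" by (rule card_image_le[OF \<S>(1)])
  ultimately have "card ((-`) co ` \<S>) \<le> (4 * m * D + 2) ^ card I" using \<S>(3) by linarith
  moreover have "\<Union>((-`) co ` \<S>) = UNIV" using \<S>(2) by (simp flip: vimage_Union)
  moreover have "sgn (f k x) = sgn (f k y)"
    if *: "S \<in> (-`) co ` \<S>" "x \<in> C \<inter> S" "y \<in> C \<inter> S" "k \<in> K" for S x y k
  proof -
    obtain S' where "S' \<in> \<S>" "co x \<in> S'" "co y \<in> S'" using * by blast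
    then have "sgn (q k (co x)) = sgn (q k (co y))" using sgn \<open>k \<in> K\<close> by blast
    then show ?thesis using * q(2) by simp
  qed
  moreover have "finite ((-`) co ` \<S>)" using \<S>(1) by (rule finite_imageI)
  ultimately show ?thesis by (intro exI[of _ "(-`) co ` \<S>"] conjI ballI)
qed

text \<open>Each cell is cut by the signs of \<open>z k x - b\<close> for all \<open>k\<close> and
  all breakpoints \<open>b\<close>, which are at most \<open>m * (2 * p)\<close> polynomials. On a
  refined cell the values of \<open>z k\<close> stay within one piece, and composing with it
  multiplies the degree by \<delta>.\<close>

lemma cellwise_poly_activation:
  assumes I: "finite I" and K: "finite K" "card K \<le> m"
    and z: "cellwise_poly co X B I D K z" and \<sigma>: "piecewise_polynomial p \<delta> \<sigma>"
  shows "cellwise_poly co X (B * (4 * (m * (2 * p)) * D + 2) ^ card I) I (\<delta> * D) K (\<lambda>k x. \<sigma> (z k x))"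
proof -
  obtain T where T: "finite T" "card T \<le> 2 * p"
    "\<And>Y. \<forall>x\<in>Y. \<forall>y\<in>Y. \<forall>b\<in>T. sgn (x - b) = sgn (y - b) \<Longrightarrow>
      \<exists>q. degree q \<le> \<delta> \<and> (\<forall>x\<in>Y. \<sigma> x = poly q x)"
    using piecewise_polynomial_breakpoints[OF \<sigma>] by metis
  obtain \<C> where \<C>: "finite \<C>" "\<Union>\<C> = X" "card \<C> \<le> B"
    "\<And>C k. C \<in> \<C> \<Longrightarrow> k \<in> K \<Longrightarrow> poly_on co C I D (z k)"
    using z unfolding cellwise_poly_def by blast
  define b where "b = (4 * (m * (2 * p)) * D + 2) ^ card I"
  have "\<exists>\<D>. finite \<D> \<and> \<Union>\<D> = X \<and> card \<D> \<le> card \<C> * b \<and>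
      (\<forall>E\<in>\<D>. \<forall>k\<in>K. poly_on co E I (\<delta> * D) (\<lambda>x. \<sigma> (z k x)))"
  proof (rule cover_refine[OF \<C>(1,2)])
    fix C assume C: "C \<in> \<C>"
    have "\<exists>\<S>. finite \<S> \<and> \<Union>\<S> = UNIV \<and> card \<S> \<le> b \<and>
      (\<forall>S\<in>\<S>. \<forall>x\<in>C \<inter> S. \<forall>y\<in>C \<inter> S. \<forall>k\<in>K \<times> T.
        sgn (z (fst k) x + - snd k) = sgn (z (fst k) y + - snd k))"
      unfolding b_def
      using C T K \<C>(4)
      by (intro sign_cover_pullback[OF I] poly_on_add poly_on_const)
        (auto simp: card_cartesian_product intro: mult_le_mono)
    then obtain \<S> where \<S>: "finite \<S>" "\<Union>\<S> = UNIV" "card \<S> \<le> b"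
      "\<forall>S\<in>\<S>. \<forall>x\<in>C \<inter> S. \<forall>y\<in>C \<inter> S. \<forall>k\<in>K \<times> T.
        sgn (z (fst k) x + - snd k) = sgn (z (fst k) y + - snd k)"
      by (elim exE conjE)
    have "poly_on co (C \<inter> S) I (\<delta> * D) (\<lambda>x. \<sigma> (z k x))" if S: "S \<in> \<S>" and k: "k \<in> K" for S k
    proof -
      have "\<exists>q. degree q \<le> \<delta> \<and> (\<forall>x\<in>z k ` (C \<inter> S). \<sigma> x = poly q x)"
      proof (intro T(3) ballI)
        fix v w b assume "v \<in> z k ` (C \<inter> S)" "w \<in> z k ` (C \<inter> S)" "b \<in> T"
        then obtain x y where xy: "v = z k x" "w = z k y" "x \<in> C \<inter> S" "y \<in> C \<inter> S" by blast
        have "(k, b) \<in> K \<times> T" using k \<open>b \<in> T\<close> by blast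
        then have "sgn (z k x + - b) = sgn (z k y + - b)"
          using \<S>(4)[rule_format, OF S xy(3,4)] by force
        then show "sgn (v - b) = sgn (w - b)" using xy by simp
      qed
      then obtain q where q: "degree q \<le> \<delta>" "\<And>x. x \<in> C \<inter> S \<Longrightarrow> \<sigma> (z k x) = poly q (z k x)"
        by blast
      obtain r where "r \<in> poly_funs I D" "\<And>x. x \<in> C \<Longrightarrow> z k x = r (co x)"
        using \<C>(4)[OF C k] unfolding poly_on_def by blast
      then show ?thesis using q by (intro poly_onI[OF poly_funs_poly]) auto
    qed
    then show "\<exists>\<S>. finite \<S> \<and> \<Union>\<S> = UNIV \<and> card \<S> \<le> b \<and>
        (\<forall>S\<in>\<S>. \<forall>k\<in>K. poly_on co (C \<inter> S) I (\<delta> * D) (\<lambda>x. \<sigma> (z k x)))"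
      using \<S>(1-3) by blast
  qed
  then obtain \<D> where \<D>: "finite \<D>" "\<Union>\<D> = X" "card \<D> \<le> card \<C> * b"
    "\<forall>E\<in>\<D>. \<forall>k\<in>K. poly_on co E I (\<delta> * D) (\<lambda>x. \<sigma> (z k x))" by blast
  have "card \<C> * b \<le> B * b" using \<C>(3) by simp
  then have "card \<D> \<le> B * b" using \<D>(3) by (rule order_trans[rotated])
  then show ?thesis
    using \<D> unfolding cellwise_poly_def b_def by (intro exI[of _ \<D>] conjI)
qed

lemma cellwise_poly_sign_cover:
  assumes I: "finite I" and K: "finite K" "card K \<le> m"
    and h: "cellwise_poly co X B I D K h"
  shows "\<exists>\<D>. finite \<D> \<and> \<Union>\<D> = X \<and> card \<D> \<le> B * (4 * m * D + 2) ^ card I \<and>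
    (\<forall>E\<in>\<D>. \<forall>x\<in>E. \<forall>y\<in>E. \<forall>k\<in>K. sgn (h k x - c) = sgn (h k y - c))"
proof -
  obtain \<C> where \<C>: "finite \<C>" "\<Union>\<C> = X" "card \<C> \<le> B"
    "\<And>C k. C \<in> \<C> \<Longrightarrow> k \<in> K \<Longrightarrow> poly_on co C I D (h k)"
    using h unfolding cellwise_poly_def by blast
  define b where "b = (4 * m * D + 2) ^ card I"
  have "\<exists>\<D>. finite \<D> \<and> \<Union>\<D> = X \<and> card \<D> \<le> card \<C> * b \<and>
      (\<forall>E\<in>\<D>. \<forall>x\<in>E. \<forall>y\<in>E. \<forall>k\<in>K. sgn (h k x + - c) = sgn (h k y + - c))"
    unfolding b_def
    by (intro cover_refine[OF \<C>(1,2)] sign_cover_pullback[where co = co, OF I K]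
        poly_on_add poly_on_const \<C>(4))
  then obtain \<D> where \<D>: "finite \<D>" "\<Union>\<D> = X" "card \<D> \<le> card \<C> * b"
    "\<forall>E\<in>\<D>. \<forall>x\<in>E. \<forall>y\<in>E. \<forall>k\<in>K. sgn (h k x - c) = sgn (h k y - c)"
    unfolding add_uminus_conv_diff by (elim exE conjE)
  have "card \<C> * b \<le> B * b" using \<C>(3) by simp
  then show ?thesis
    using \<D> unfolding b_def by (intro exI[of _ \<D>] conjI) (simp_all only: le_trans)
qed

section \<open>Weisfeiler--Leman colours and message passing\<close>

lemma finite_nbh: "finite (nbh G v)"
  by (simp add: nbh_def verts_def)

lemma wl_antimono:
  assumes "wl G t' v = wl G t' w" "t \<le> t'"
  shows "wl G t v = wl G t w"
  using assms(2,1) by (induction rule: dec_induct) auto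

definition wl_stable :: "fgraph \<Rightarrow> nat \<Rightarrow> bool" where
  "wl_stable G t \<longleftrightarrow>
     (\<forall>v\<in>verts G. \<forall>w\<in>verts G. wl G t v = wl G t w \<longrightarrow> wl G (Suc t) v = wl G (Suc t) w)"

text \<open>At a stable round the next colour is a function \<phi> of the current one, so the
  multiset of current neighbour colours determines that of the next colours.\<close>

lemma wl_stable_Suc:
  assumes "wl_stable G t"
  shows "wl_stable G (Suc t)"
  unfolding wl_stable_def
proof (intro ballI impI)
  fix v w assume vw: "v \<in> verts G" "w \<in> verts G" "wl G (Suc t) v = wl G (Suc t) w"
  define \<phi> where "\<phi> c = wl G (Suc t) (SOME x. x \<in> verts G \<and> wl G t x = c)" for c
  have \<phi>: "\<phi> (wl G t x) = wl G (Suc t) x" if "x \<in> verts G" for x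
  proof -
    let ?y = "SOME y. y \<in> verts G \<and> wl G t y = wl G t x"
    have "?y \<in> verts G \<and> wl G t ?y = wl G t x"
      using that by (intro someI[of "\<lambda>y. y \<in> verts G \<and> wl G t y = wl G t x" x]) simp
    then show ?thesis using assms that unfolding \<phi>_def wl_stable_def by blast
  qed
  have nbh: "image_mset (wl G (Suc t)) (mset_set (nbh G x)) =
      image_mset \<phi> (image_mset (wl G t) (mset_set (nbh G x)))" for x
    unfolding image_mset.compositionality
    using \<phi> by (intro image_mset_cong) (auto simp: finite_nbh nbh_def verts_def)
  have "image_mset (wl G t) (mset_set (nbh G v)) = image_mset (wl G t) (mset_set (nbh G w))"
    using vw(3) by simp
  then have "image_mset (wl G (Suc t)) (mset_set (nbh G v)) =
      image_mset (wl G (Suc t)) (mset_set (nbh G w))"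
    unfolding nbh by (rule arg_cong)
  then show "wl G (Suc (Suc t)) v = wl G (Suc (Suc t)) w"
    using vw(3) by (simp only: wl.simps(2)[of G "Suc t"])
qed

text \<open>Stripping the outer \<open>Relabel\<close> maps the new colours onto the old ones. If
  this map were injective, no class would have split, so instability forces a strict
  increase.\<close>

lemma card_wl_Suc_gt:
  assumes "\<not> wl_stable G t"
  shows "card (wl G t ` verts G) < card (wl G (Suc t) ` verts G)"
proof -
  define \<pi> where "\<pi> c = (case c of Relabel a M \<Rightarrow> a | Feature _ \<Rightarrow> c)" for c
  have \<pi>: "\<pi> (wl G (Suc t) x) = wl G t x" for x by (simp add: \<pi>_def)
  have fin: "finite (wl G (Suc t) ` verts G)" by (simp add: verts_def)
  have img: "\<pi> ` (wl G (Suc t) ` verts G) = wl G t ` verts G"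
    by (simp only: image_image \<pi>)
  have "\<not> inj_on \<pi> (wl G (Suc t) ` verts G)"
  proof
    assume inj: "inj_on \<pi> (wl G (Suc t) ` verts G)"
    have "wl_stable G t"
      unfolding wl_stable_def
    proof (intro ballI impI)
      fix v w assume vw: "v \<in> verts G" "w \<in> verts G" "wl G t v = wl G t w"
      then have "\<pi> (wl G (Suc t) v) = \<pi> (wl G (Suc t) w)" by (simp only: \<pi>)
      then show "wl G (Suc t) v = wl G (Suc t) w"
        by (rule inj_onD[OF inj _ imageI[OF vw(1)] imageI[OF vw(2)]])
    qed
    then show False using assms by simp
  qed
  then have "card (\<pi> ` (wl G (Suc t) ` verts G)) \<noteq> card (wl G (Suc t) ` verts G)"
    using fin eq_card_imp_inj_on by blast
  then show ?thesis using card_image_le[OF fin, of \<pi>] unfolding img by linarith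
qed

text \<open>Every unstable round adds a colour, and there is at least one at the start; too many
  such rounds would give more colours than vertices.\<close>

lemma wl_stable_num_verts:
  assumes "verts G \<noteq> {}"
  shows "\<exists>t\<le>num_verts G. wl_stable G t"
proof (rule ccontr)
  assume "\<not> ?thesis"
  then have unstable: "\<not> wl_stable G t" if "t \<le> num_verts G" for t using that by blast
  have "t < card (wl G t ` verts G)" if "t \<le> num_verts G" for t
    using that
  proof (induction t)
    case 0
    then show ?case using assms by (simp add: verts_def card_gt_0_iff)
  next
    case (Suc t)
    then show ?case using card_wl_Suc_gt[OF unstable[of t]] by linarith
  qed
  from this[of "num_verts G"] have "num_verts G < card (wl G (num_verts G) ` verts G)" by simp
  also have "\<dots> \<le> num_verts G"
    using card_image_le[of "verts G" "wl G (num_verts G)"] by (simp add: verts_def)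
  finally show False by simp
qed

text \<open>Colour complexity is measured at round \<open>num_verts G\<close>, but a GNN may have
  more layers than that. Earlier colours are contained in later ones, and stability carries equality
  to all later rounds.\<close>

lemma wl_eq_num_verts_imp_eq:
  assumes "v \<in> verts G" "w \<in> verts G" "wl G (num_verts G) v = wl G (num_verts G) w"
  shows "wl G t v = wl G t w"
proof -
  obtain t0 where t0: "t0 \<le> num_verts G" "wl_stable G t0"
    using wl_stable_num_verts assms(1) by blast
  have stable: "wl_stable G t" if "t0 \<le> t" for t
    using that by (induction rule: dec_induct) (simp_all add: t0 wl_stable_Suc)
  show ?thesis
  proof (cases "t \<le> num_verts G")
    case True
    then show ?thesis using assms(3) by (rule wl_antimono[rotated])
  next
    case False
    then have "num_verts G \<le> t" by simp
    then show ?thesis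
    proof (induction rule: dec_induct)
      case base
      show ?case by (rule assms(3))
    next
      case (step k)
      then have "wl_stable G k" using stable t0(1) by simp
      then show ?case using step.IH assms(1,2) unfolding wl_stable_def by blast
    qed
  qed
qed

text \<open>Within a fixed graph, features at layer \<open>t\<close> are a function \<psi> of the
  colours at round \<open>t\<close>; hence the neighbour sum depends only on the multiset of
  neighbour colours.\<close>

lemma gnn_layer_eq_if_wl_eq:
  "wl G t v = wl G t w \<Longrightarrow> gnn_layer d \<sigma> \<Theta> G t v = gnn_layer d \<sigma> \<Theta> G t w"
proof (induction t arbitrary: v w)
  case 0
  then show ?case by simp
next
  case (Suc t)
  define \<psi> where "\<psi> c = gnn_layer d \<sigma> \<Theta> G t (SOME x. wl G t x = c)" for c
  have \<psi>: "gnn_layer d \<sigma> \<Theta> G t x = \<psi> (wl G t x)" for x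
    unfolding \<psi>_def by (rule Suc.IH) (rule someI[of "\<lambda>y. wl G t y = wl G t x" x, symmetric], simp)
  have "(\<Sum>x\<in>nbh G y. gnn_layer d \<sigma> \<Theta> G t x \<bullet> c) =
      \<Sum>\<^sub># (image_mset (\<lambda>k. \<psi> k \<bullet> c) (image_mset (wl G t) (mset_set (nbh G y))))" for y c
    unfolding \<psi> sum_unfold_sum_mset image_mset.compositionality comp_def by simp
  moreover have "gnn_layer d \<sigma> \<Theta> G t v = gnn_layer d \<sigma> \<Theta> G t w"
    using Suc.prems by (intro Suc.IH) simp
  moreover have "image_mset (wl G t) (mset_set (nbh G v)) = image_mset (wl G t) (mset_set (nbh G w))"
    using Suc.prems by simp
  ultimately show ?case by simp
qed

text \<open>The order of quantifiers matters: one map \<open>r\<close> works for all parameters and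
  layers simultaneously, so the same representatives can be used on every cell.\<close>

lemma color_complexity_representatives:
  assumes "color_complexity G \<le> u"
  shows "\<exists>r. r ` verts G \<subseteq> verts G \<and> card (r ` verts G) \<le> u \<and>
    (\<forall>v\<in>verts G. \<forall>d \<sigma> \<Theta> t. gnn_layer d \<sigma> \<Theta> G t v = gnn_layer d \<sigma> \<Theta> G t (r v))"
proof -
  define \<rho> where "\<rho> c = (SOME x. x \<in> verts G \<and> wl G (num_verts G) x = c)" for c
  define r where "r v = \<rho> (wl G (num_verts G) v)" for v
  have r: "r v \<in> verts G \<and> wl G (num_verts G) (r v) = wl G (num_verts G) v" if "v \<in> verts G" for v
    unfolding r_def \<rho>_def
    using that by (intro someI[of "\<lambda>y. y \<in> verts G \<and> wl G (num_verts G) y = wl G (num_verts G) v" v]) simp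
  have "r ` verts G = \<rho> ` (wl G (num_verts G) ` verts G)" by (simp add: r_def image_image)
  then have "card (r ` verts G) \<le> color_complexity G"
    unfolding color_complexity_def by (simp add: card_image_le verts_def)
  moreover have "gnn_layer d \<sigma> \<Theta> G t v = gnn_layer d \<sigma> \<Theta> G t (r v)" if "v \<in> verts G" for v d \<sigma> \<Theta> t
    by (rule gnn_layer_eq_if_wl_eq, rule wl_eq_num_verts_imp_eq) (use r[OF that] that in simp_all)
  ultimately show ?thesis using r assms by (intro exI[of _ r] conjI image_subsetI) auto
qed

section \<open>Coordinates on the parameter space and degrees of preactivations\<close>

datatype param_index =
  W1_entry nat nat nat | W2_entry nat nat nat | Bias_entry nat nat | W_out_entry nat | B_out

primrec coord :: "gnn_params \<Rightarrow> param_index \<Rightarrow> real" where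
  "coord \<Theta> (W1_entry t a b) = W1 \<Theta> t $$ (a, b)"
| "coord \<Theta> (W2_entry t a b) = W2 \<Theta> t $$ (a, b)"
| "coord \<Theta> (Bias_entry t b) = bias \<Theta> t $ b"
| "coord \<Theta> (W_out_entry a) = w_out \<Theta> $ a"
| "coord \<Theta> B_out = b_out \<Theta>"

definition layer_params :: "nat \<Rightarrow> nat \<Rightarrow> param_index set" where
  "layer_params d t = (\<lambda>(a, b). W1_entry t a b) ` ({..<d} \<times> {..<d}) \<union>
     (\<lambda>(a, b). W2_entry t a b) ` ({..<d} \<times> {..<d}) \<union> Bias_entry t ` {..<d}"

definition readout_params :: "nat \<Rightarrow> param_index set" where
  "readout_params d = insert B_out (W_out_entry ` {..<d})"

definition all_params :: "nat \<Rightarrow> nat \<Rightarrow> param_index set" where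
  "all_params d L = (\<Union>t\<in>{1..L}. layer_params d t) \<union> readout_params d"

lemma finite_params [simp]:
  "finite (layer_params d t)" "finite (readout_params d)" "finite (all_params d L)"
  by (simp_all add: layer_params_def readout_params_def all_params_def)

lemma card_layer_params: "card (layer_params d t) \<le> d * (2 * d + 1)"
proof -
  have "card (layer_params d t) \<le> card ({..<d} \<times> {..<d}) + card ({..<d} \<times> {..<d}) + card {..<d}"
    unfolding layer_params_def
    by (intro order_trans[OF card_Un_le] add_mono card_image_le) auto
  then show ?thesis by (simp add: algebra_simps)
qed

lemma card_readout_params: "card (readout_params d) \<le> d + 1"
  unfolding readout_params_def
  using card_image_le[of "{..<d}" W_out_entry] by (simp add: card_insert_if)

lemma num_params_eq: "num_params d L = L * (d * (2 * d + 1)) + (d + 1)"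
  by (simp add: num_params_def algebra_simps)

lemma card_all_params: "card (all_params d L) \<le> num_params d L"
proof -
  have "card (\<Union>t\<in>{1..L}. layer_params d t) \<le> (\<Sum>t\<in>{1..L}. card (layer_params d t))"
    by (rule card_UN_le) simp
  also have "\<dots> \<le> (\<Sum>t\<in>{1..L}. d * (2 * d + 1))" by (intro sum_mono card_layer_params)
  finally have "card (\<Union>t\<in>{1..L}. layer_params d t) \<le> L * (d * (2 * d + 1))" by simp
  then show ?thesis
    unfolding all_params_def num_params_eq
    using card_readout_params by (intro order_trans[OF card_Un_le] add_mono)
qed

lemma scalar_prod_lessThan:
  assumes "dim_vec w = d"
  shows "v \<bullet> w = (\<Sum>a<d. v $ a * w $ a)"
  using assms by (simp add: scalar_prod_def lessThan_atLeast0)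

lemma poly_on_scalar_prod:
  assumes h: "\<And>a. a < d \<Longrightarrow> poly_on co C I D (\<lambda>x. h x $ a)"
    and w: "\<And>x. x \<in> C \<Longrightarrow> dim_vec (w x) = d"
    and var: "\<And>x a. x \<in> C \<Longrightarrow> a < d \<Longrightarrow> w x $ a = co x (\<iota> a)" "\<And>a. a < d \<Longrightarrow> \<iota> a \<in> J"
    and I: "I \<subseteq> J" "finite J"
  shows "poly_on co C J (D + 1) (\<lambda>x. h x \<bullet> w x)"
proof (rule poly_on_cong)
  show "poly_on co C J (D + 1) (\<lambda>x. \<Sum>a<d. h x $ a * co x (\<iota> a))"
    using h var(2) I
    by (intro poly_on_sum poly_on_mult poly_on_var) (auto intro: poly_on_mono)
  show "h x \<bullet> w x = (\<Sum>a<d. h x $ a * co x (\<iota> a))" if "x \<in> C" for x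
    using scalar_prod_lessThan[OF w[OF that]] var(1)[OF that] by simp
qed

definition layer_preact :: "nat \<Rightarrow> (nat \<Rightarrow> real \<Rightarrow> real) \<Rightarrow> gnn_params \<Rightarrow> fgraph \<Rightarrow> nat \<Rightarrow> nat \<Rightarrow> nat \<Rightarrow> real" where
  "layer_preact d \<sigma> \<Theta> G t v j =
     gnn_layer d \<sigma> \<Theta> G t v \<bullet> col (W1 \<Theta> (Suc t)) j
     + (\<Sum>w\<in>nbh G v. gnn_layer d \<sigma> \<Theta> G t w \<bullet> col (W2 \<Theta> (Suc t)) j)
     + bias \<Theta> (Suc t) $ j"

lemma gnn_layer_Suc_nth:
  "j < d \<Longrightarrow> gnn_layer d \<sigma> \<Theta> G (Suc t) v $ j = \<sigma> (Suc t) (layer_preact d \<sigma> \<Theta> G t v j)"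
  by (simp add: layer_preact_def)

text \<open>Every product is a feature times one parameter, hence the degree \<open>D + 1\<close>.
  The sum over neighbours leaves the degree unchanged, however many there are.\<close>

lemma poly_on_layer_preact:
  assumes C: "C \<subseteq> gnn_param_space d L" and t: "t < L" and v: "v \<in> verts G" and j: "j < d"
    and h: "\<And>w a. w \<in> verts G \<Longrightarrow> a < d \<Longrightarrow> poly_on coord C I D (\<lambda>\<Theta>. gnn_layer d \<sigma> \<Theta> G t w $ a)"
    and I: "I \<subseteq> J" "layer_params d (Suc t) \<subseteq> J" "finite J"
  shows "poly_on coord C J (D + 1) (\<lambda>\<Theta>. layer_preact d \<sigma> \<Theta> G t v j)"
proof -
  have dim: "dim_row (W1 \<Theta> (Suc t)) = d" "dim_col (W1 \<Theta> (Suc t)) = d"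
    "dim_row (W2 \<Theta> (Suc t)) = d" "dim_col (W2 \<Theta> (Suc t)) = d" if "\<Theta> \<in> C" for \<Theta>
  proof -
    have "W1 \<Theta> (Suc t) \<in> carrier_mat d d" "W2 \<Theta> (Suc t) \<in> carrier_mat d d"
      using that C t by (auto simp: gnn_param_space_def)
    then show "dim_row (W1 \<Theta> (Suc t)) = d" "dim_col (W1 \<Theta> (Suc t)) = d"
      "dim_row (W2 \<Theta> (Suc t)) = d" "dim_col (W2 \<Theta> (Suc t)) = d" by auto
  qed
  have col: "col (W1 \<Theta> (Suc t)) j $ a = coord \<Theta> (W1_entry (Suc t) a j)"
    "col (W2 \<Theta> (Suc t)) j $ a = coord \<Theta> (W2_entry (Suc t) a j)" if "\<Theta> \<in> C" "a < d" for \<Theta> a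
    using dim[OF that(1)] that(2) j by simp_all
  have ent: "W1_entry (Suc t) a j \<in> J" "W2_entry (Suc t) a j \<in> J" "Bias_entry (Suc t) j \<in> J" if "a < d" for a
    using I(2) that j by (auto simp: layer_params_def)
  have "poly_on coord C J (D + 1) (\<lambda>\<Theta>. gnn_layer d \<sigma> \<Theta> G t v \<bullet> col (W1 \<Theta> (Suc t)) j)"
  proof (rule poly_on_scalar_prod[where \<iota> = "\<lambda>a. W1_entry (Suc t) a j", OF h[OF v] _ _ _ I(1,3)])
    show "col (W1 \<Theta> (Suc t)) j $ a = coord \<Theta> (W1_entry (Suc t) a j)" if "\<Theta> \<in> C" "a < d" for \<Theta> a
      using that by (rule col)
    show "W1_entry (Suc t) a j \<in> J" if "a < d" for a using that by (rule ent)
    show "dim_vec (col (W1 \<Theta> (Suc t)) j) = d" if "\<Theta> \<in> C" for \<Theta>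
      using dim(1)[OF that] by simp
  qed
  moreover have "poly_on coord C J (D + 1) (\<lambda>\<Theta>. gnn_layer d \<sigma> \<Theta> G t w \<bullet> col (W2 \<Theta> (Suc t)) j)"
    if "w \<in> nbh G v" for w
  proof -
    have w: "w \<in> verts G" using that by (simp add: nbh_def)
    show ?thesis
    proof (rule poly_on_scalar_prod[where \<iota> = "\<lambda>a. W2_entry (Suc t) a j", OF h[OF w] _ _ _ I(1,3)])
      show "col (W2 \<Theta> (Suc t)) j $ a = coord \<Theta> (W2_entry (Suc t) a j)" if "\<Theta> \<in> C" "a < d" for \<Theta> a
        using that by (rule col)
      show "W2_entry (Suc t) a j \<in> J" if "a < d" for a using that by (rule ent)
      show "dim_vec (col (W2 \<Theta> (Suc t)) j) = d" if "\<Theta> \<in> C" for \<Theta>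
        using dim(3)[OF that] by simp
    qed
  qed
  moreover have "poly_on coord C J (D + 1) (\<lambda>\<Theta>. coord \<Theta> (Bias_entry (Suc t) j))"
    using ent j I by (intro poly_on_var) auto
  ultimately show ?thesis
    unfolding layer_preact_def by (intro poly_on_add poly_on_sum) simp_all
qed

definition readout_preact :: "nat \<Rightarrow> nat \<Rightarrow> (nat \<Rightarrow> real \<Rightarrow> real) \<Rightarrow> gnn_params \<Rightarrow> fgraph \<Rightarrow> real" where
  "readout_preact d L \<sigma> \<Theta> G = (\<Sum>v\<in>verts G. gnn_layer d \<sigma> \<Theta> G L v \<bullet> w_out \<Theta>) + b_out \<Theta>"

lemma poly_on_readout_preact:
  assumes C: "C \<subseteq> gnn_param_space d L"
    and h: "\<And>w a. w \<in> verts G \<Longrightarrow> a < d \<Longrightarrow> poly_on coord C I D (\<lambda>\<Theta>. gnn_layer d \<sigma> \<Theta> G L w $ a)"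
    and I: "I \<subseteq> J" "readout_params d \<subseteq> J" "finite J"
  shows "poly_on coord C J (D + 1) (\<lambda>\<Theta>. readout_preact d L \<sigma> \<Theta> G)"
proof -
  have "poly_on coord C J (D + 1) (\<lambda>\<Theta>. gnn_layer d \<sigma> \<Theta> G L v \<bullet> w_out \<Theta>)" if "v \<in> verts G" for v
  proof (rule poly_on_scalar_prod[where \<iota> = W_out_entry, OF h[OF that] _ _ _ I(1,3)])
    show "dim_vec (w_out \<Theta>) = d" if "\<Theta> \<in> C" for \<Theta>
      using that C by (auto simp: gnn_param_space_def)
    show "W_out_entry a \<in> J" if "a < d" for a
      using that I(2) by (auto simp: readout_params_def)
  qed simp_all
  moreover have "poly_on coord C J (D + 1) (\<lambda>\<Theta>. coord \<Theta> B_out)"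
    using I by (intro poly_on_var) (auto simp: readout_params_def)
  ultimately show ?thesis
    unfolding readout_preact_def by (intro poly_on_add poly_on_sum) simp_all
qed

text \<open>A function of degree 0 is constant on the cell, so the set of variables can be exchanged
  at will; with the empty set, the parameters of past layers are discarded.\<close>

lemma poly_on_degree_0:
  assumes "poly_on co C I 0 f" "finite I"
  shows "poly_on co C J 0 f"
proof -
  obtain q where q: "q \<in> poly_funs I 0" "\<And>x. x \<in> C \<Longrightarrow> f x = q (co x)"
    using assms(1) unfolding poly_on_def by blast
  have "q \<in> poly_funs {} 0" using q(1) assms(2) by (rule poly_funs_degree_0)
  then have "q x = q y" for x y by (rule poly_funs_cong_vars) simp
  then have "q = (\<lambda>x. q (\<lambda>_. 0))" by blast
  then have "q \<in> poly_funs J 0" using poly_funs_const by metis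
  then show ?thesis using q(2) by (rule poly_onI)
qed

text \<open>Input features have degree 0 in the parameters, an affine step adds 1 and an activation
  multiplies by \<delta>. The closed form is \<delta> + \<delta>^2 + ... + \<delta>^t.\<close>

primrec layer_degree :: "nat \<Rightarrow> nat \<Rightarrow> nat" where
  "layer_degree \<delta> 0 = 0"
| "layer_degree \<delta> (Suc t) = \<delta> * (layer_degree \<delta> t + 1)"

lemma layer_degree_0: "layer_degree 0 t = 0"
  by (cases t) simp_all

lemma layer_degree_le:
  assumes "\<delta> \<ge> 1"
  shows "layer_degree \<delta> t \<le> t * \<delta> ^ t"
proof (induction t)
  case (Suc t)
  have "\<delta> * (layer_degree \<delta> t + 1) \<le> \<delta> * (t * \<delta> ^ t + \<delta> ^ t)"
    using Suc assms by (intro mult_left_mono add_mono) simp_all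
  then show ?case by (simp add: algebra_simps)
qed simp

section \<open>Counting the cells of a GNN class\<close>

text \<open>For \<open>\<delta> = 0\<close> the features are constant on every cell, so the next layer only involves its own
  parameters; this is what saves the factor \<open>L\<close>.\<close>

lemma cellwise_gnn_layer:
  assumes G: "\<And>i. i < m \<Longrightarrow> G i \<in> graph_class d u"
    and \<sigma>: "\<And>s. s \<in> {1..L} \<Longrightarrow> piecewise_polynomial p \<delta> (\<sigma> s)"
    and \<Delta>: "\<And>s. s \<le> L \<Longrightarrow> layer_degree \<delta> s + 1 \<le> \<Delta>"
    and b: "b = 4 * (m * (u * d) * (2 * p)) * \<Delta> + 2"
    and t: "t \<le> L"
  shows "cellwise_poly coord (gnn_param_space d L)
    (b ^ (t * (if \<delta> = 0 then d * (2 * d + 1) else num_params d L)))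
    (if \<delta> = 0 then {} else all_params d L) (layer_degree \<delta> t)
    (SIGMA i:{..<m}. verts (G i) \<times> {..<d}) (\<lambda>(i, v, j) \<Theta>. gnn_layer d \<sigma> \<Theta> (G i) t v $ j)"
  using t
proof (induction t)
  case 0
  then show ?case
    unfolding cellwise_poly_def
    by (intro exI[of _ "{gnn_param_space d L}"]) (auto intro!: poly_on_const)
next
  case (Suc t)
  have "\<exists>r. \<forall>i<m. r i ` verts (G i) \<subseteq> verts (G i) \<and> card (r i ` verts (G i)) \<le> u \<and>
      (\<forall>v\<in>verts (G i). \<forall>d \<sigma> \<Theta> t. gnn_layer d \<sigma> \<Theta> (G i) t v = gnn_layer d \<sigma> \<Theta> (G i) t (r i v))"
    using color_complexity_representatives G unfolding graph_class_def
    by (intro choice_iff'[THEN iffD1]) blast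
  then obtain r where r: "\<And>i. i < m \<Longrightarrow> r i ` verts (G i) \<subseteq> verts (G i)"
    "\<And>i. i < m \<Longrightarrow> card (r i ` verts (G i)) \<le> u"
    "\<And>i v d \<sigma> \<Theta> t. i < m \<Longrightarrow> v \<in> verts (G i) \<Longrightarrow>
       gnn_layer d \<sigma> \<Theta> (G i) t v = gnn_layer d \<sigma> \<Theta> (G i) t (r i v)"
    by metis
  define n where "n = (if \<delta> = 0 then d * (2 * d + 1) else num_params d L)"
  define I where "I = (if \<delta> = 0 then {} else all_params d L)"
  define J where "J = (if \<delta> = 0 then layer_params d (Suc t) else all_params d L)"
  define D where "D = layer_degree \<delta> t"
  \<comment> \<open>Polynomiality is needed at all vertices (\<open>K\<close>), because neighbour
    sums run over them; the cuts are made only for representatives (\<open>R\<close>), whose number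
    is at most \<open>m * (u * d)\<close>.\<close>
  define K where "K = (SIGMA i:{..<m}. verts (G i) \<times> {..<d})"
  define R where "R = (SIGMA i:{..<m}. r i ` verts (G i) \<times> {..<d})"
  have "layer_params d (Suc t) \<subseteq> all_params d L"
    using Suc.prems by (force simp: all_params_def)
  then have J: "finite J" "card J \<le> n" "I \<subseteq> J" "layer_params d (Suc t) \<subseteq> J"
    unfolding J_def I_def n_def using card_layer_params card_all_params by simp_all
  have fin: "finite (verts (G i))" for i by (simp add: verts_def)
  have "card R = (\<Sum>i<m. card (r i ` verts (G i)) * d)"
    unfolding R_def using fin by (subst card_SigmaI) (simp_all add: card_cartesian_product)
  also have "\<dots> \<le> (\<Sum>i<m. u * d)" using r(2) by (intro sum_mono mult_right_mono) auto
  finally have R: "finite R" "card R \<le> m * (u * d)" using fin by (simp_all add: R_def)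
  have "cellwise_poly coord (gnn_param_space d L) (b ^ (t * n)) J (D + 1) R
      (\<lambda>(i, v, j) \<Theta>. layer_preact d \<sigma> \<Theta> (G i) t v j)"
  proof (rule cellwise_poly_lift)
    show "cellwise_poly coord (gnn_param_space d L) (b ^ (t * n)) I D K
        (\<lambda>(i, v, j) \<Theta>. gnn_layer d \<sigma> \<Theta> (G i) t v $ j)"
      using Suc unfolding n_def I_def D_def K_def by simp
  next
    fix C and k :: "nat \<times> nat \<times> nat"
    assume C: "C \<subseteq> gnn_param_space d L"
      and h: "\<And>k. k \<in> K \<Longrightarrow> poly_on coord C I D ((\<lambda>(i, v, j) \<Theta>. gnn_layer d \<sigma> \<Theta> (G i) t v $ j) k)"
      and "k \<in> R"
    then obtain i v j where k: "k = (i, v, j)" "i < m" "v \<in> verts (G i)" "j < d"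
      using r(1) by (fastforce simp: R_def)
    have "poly_on coord C J (D + 1) (\<lambda>\<Theta>. layer_preact d \<sigma> \<Theta> (G i) t v j)"
    proof (rule poly_on_layer_preact[OF C _ k(3,4) _ J(3,4,1)])
      show "poly_on coord C I D (\<lambda>\<Theta>. gnn_layer d \<sigma> \<Theta> (G i) t w $ a)" if "w \<in> verts (G i)" "a < d" for w a
        using h[of "(i, w, a)"] that k(2) by (simp add: K_def)
    qed (use Suc.prems in simp)
    then show "poly_on coord C J (D + 1) ((\<lambda>(i, v, j) \<Theta>. layer_preact d \<sigma> \<Theta> (G i) t v j) k)"
      by (simp add: k(1))
  qed simp
  then have act: "cellwise_poly coord (gnn_param_space d L)
      (b ^ (t * n) * (4 * (m * (u * d) * (2 * p)) * (D + 1) + 2) ^ card J) J (\<delta> * (D + 1)) R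
      (\<lambda>k \<Theta>. \<sigma> (Suc t) ((\<lambda>(i, v, j) \<Theta>. layer_preact d \<sigma> \<Theta> (G i) t v j) k \<Theta>))"
    using R Suc.prems by (intro cellwise_poly_activation[OF J(1)] \<sigma>) simp_all
  have "(4 * (m * (u * d) * (2 * p)) * (D + 1) + 2) ^ card J \<le> b ^ card J"
    unfolding b using \<Delta>[of t] Suc.prems
    by (intro power_mono add_right_mono mult_left_mono) (simp_all add: D_def)
  also have "\<dots> \<le> b ^ n" using J(2) by (intro power_increasing) (simp_all add: b)
  finally have bound: "b ^ (t * n) * (4 * (m * (u * d) * (2 * p)) * (D + 1) + 2) ^ card J \<le> b ^ (Suc t * n)"
    by (simp add: power_add mult.commute)
  have "cellwise_poly coord (gnn_param_space d L) (b ^ (Suc t * n)) I (\<delta> * (D + 1)) K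
      (\<lambda>(i, v, j) \<Theta>. gnn_layer d \<sigma> \<Theta> (G i) (Suc t) v $ j)"
  proof (rule cellwise_poly_lift[OF act bound])
    fix C and k :: "nat \<times> nat \<times> nat"
    assume C: "C \<subseteq> gnn_param_space d L"
      and h: "\<And>k. k \<in> R \<Longrightarrow> poly_on coord C J (\<delta> * (D + 1))
        (\<lambda>\<Theta>. \<sigma> (Suc t) ((\<lambda>(i, v, j) \<Theta>. layer_preact d \<sigma> \<Theta> (G i) t v j) k \<Theta>))"
      and "k \<in> K"
    then obtain i v j where k: "k = (i, v, j)" "i < m" "v \<in> verts (G i)" "j < d"
      by (auto simp: K_def)
    have "poly_on coord C J (\<delta> * (D + 1)) (\<lambda>\<Theta>. gnn_layer d \<sigma> \<Theta> (G i) (Suc t) v $ j)"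
    proof (rule poly_on_cong)
      show "poly_on coord C J (\<delta> * (D + 1)) (\<lambda>\<Theta>. \<sigma> (Suc t) (layer_preact d \<sigma> \<Theta> (G i) t (r i v) j))"
        using h[of "(i, r i v, j)"] k by (simp add: R_def)
      show "gnn_layer d \<sigma> \<Theta> (G i) (Suc t) v $ j = \<sigma> (Suc t) (layer_preact d \<sigma> \<Theta> (G i) t (r i v) j)" for \<Theta>
        unfolding r(3)[OF k(2,3), of _ _ _ "Suc t"] by (rule gnn_layer_Suc_nth[OF k(4)])
    qed
    \<comment> \<open>For \<delta> = 0 the layer's own parameters are forgotten here, so that the
      next layer starts again without variables.\<close>
    then have "poly_on coord C I (\<delta> * (D + 1)) (\<lambda>\<Theta>. gnn_layer d \<sigma> \<Theta> (G i) (Suc t) v $ j)"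
    proof (cases "\<delta> = 0")
      case True
      then show ?thesis
        using \<open>poly_on coord C J (\<delta> * (D + 1)) _\<close> J(1) by (simp add: poly_on_degree_0)
    qed (simp add: I_def J_def)
    then show "poly_on coord C I (\<delta> * (D + 1)) ((\<lambda>(i, v, j) \<Theta>. gnn_layer d \<sigma> \<Theta> (G i) (Suc t) v $ j) k)"
      by (simp only: k(1) prod.case)
  qed
  then show ?case by (simp only: n_def I_def D_def K_def layer_degree.simps)
qed

text \<open>The readout adds \<open>d + 1\<close> variables to the
  \<open>L * (d * (2 * d + 1))\<close> accumulated for \<delta> = 0, which is exactly P. For
  positive \<delta> it adds a further full P.\<close>

lemma cellwise_gnn:
  assumes G: "\<And>i. i < m \<Longrightarrow> G i \<in> graph_class d u"
    and \<sigma>: "\<And>s. s \<in> {1..L + 1} \<Longrightarrow> piecewise_polynomial p \<delta> (\<sigma> s)"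
    and \<Delta>: "\<And>s. s \<le> L \<Longrightarrow> layer_degree \<delta> s + 1 \<le> \<Delta>"
    and b: "b = 4 * (m * (u * d) * (2 * p)) * \<Delta> + 2"
    and pos: "d \<ge> 1" "u \<ge> 1"
  shows "cellwise_poly coord (gnn_param_space d L)
    (b ^ (if \<delta> = 0 then num_params d L else (L + 1) * num_params d L))
    (if \<delta> = 0 then {} else all_params d L) (layer_degree \<delta> (Suc L)) {..<m}
    (\<lambda>i \<Theta>. gnn d L \<sigma> \<Theta> (G i))"
proof -
  define n where "n = (if \<delta> = 0 then d * (2 * d + 1) else num_params d L)"
  define I where "I = (if \<delta> = 0 then {} else all_params d L)"
  define J where "J = (if \<delta> = 0 then readout_params d else all_params d L)"
  define e where "e = (if \<delta> = 0 then d + 1 else num_params d L)"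
  define D where "D = layer_degree \<delta> L"
  define K where "K = (SIGMA i:{..<m}. verts (G i) \<times> {..<d})"
  have J: "finite J" "card J \<le> e" "I \<subseteq> J" "readout_params d \<subseteq> J"
    unfolding J_def I_def e_def using card_readout_params card_all_params
    by (simp_all add: all_params_def)
  have "cellwise_poly coord (gnn_param_space d L) (b ^ (L * n)) J (D + 1) {..<m}
      (\<lambda>i \<Theta>. readout_preact d L \<sigma> \<Theta> (G i))"
  proof (rule cellwise_poly_lift)
    show "cellwise_poly coord (gnn_param_space d L) (b ^ (L * n)) I D K
        (\<lambda>(i, v, j) \<Theta>. gnn_layer d \<sigma> \<Theta> (G i) L v $ j)"
      unfolding n_def I_def D_def K_def
      using \<sigma> by (intro cellwise_gnn_layer[where u = u and p = p and \<Delta> = \<Delta>] G \<Delta> b) auto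
  next
    fix C i
    assume C: "C \<subseteq> gnn_param_space d L"
      and h: "\<And>k. k \<in> K \<Longrightarrow> poly_on coord C I D ((\<lambda>(i, v, j) \<Theta>. gnn_layer d \<sigma> \<Theta> (G i) L v $ j) k)"
      and i: "i \<in> {..<m}"
    show "poly_on coord C J (D + 1) (\<lambda>\<Theta>. readout_preact d L \<sigma> \<Theta> (G i))"
    proof (rule poly_on_readout_preact[OF C _ J(3,4,1)])
      show "poly_on coord C I D (\<lambda>\<Theta>. gnn_layer d \<sigma> \<Theta> (G i) L w $ a)" if "w \<in> verts (G i)" "a < d" for w a
        using h[of "(i, w, a)"] that i by (simp add: K_def)
    qed
  qed simp
  then have act: "cellwise_poly coord (gnn_param_space d L)
      (b ^ (L * n) * (4 * (m * (2 * p)) * (D + 1) + 2) ^ card J) J (\<delta> * (D + 1)) {..<m}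
      (\<lambda>i \<Theta>. \<sigma> (Suc L) (readout_preact d L \<sigma> \<Theta> (G i)))"
    by (intro cellwise_poly_activation[OF J(1)] \<sigma>) simp_all
  have "m * 1 * (2 * p) \<le> m * (u * d) * (2 * p)"
    using pos by (intro mult_right_mono mult_left_mono) simp_all
  then have "4 * (m * (2 * p)) * (D + 1) + 2 \<le> b"
    unfolding b using \<Delta>[of L] pos
    by (intro add_right_mono mult_le_mono) (simp_all add: D_def)
  then have "(4 * (m * (2 * p)) * (D + 1) + 2) ^ card J \<le> b ^ card J" by (intro power_mono) simp_all
  also have "\<dots> \<le> b ^ e" using J(2) by (intro power_increasing) (simp_all add: b)
  finally have "b ^ (L * n) * (4 * (m * (2 * p)) * (D + 1) + 2) ^ card J \<le> b ^ (L * n + e)"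
    by (simp add: power_add)
  then have bound: "b ^ (L * n) * (4 * (m * (2 * p)) * (D + 1) + 2) ^ card J \<le>
      b ^ (if \<delta> = 0 then num_params d L else (L + 1) * num_params d L)"
    by (simp add: n_def e_def num_params_eq algebra_simps split: if_splits)
  have "cellwise_poly coord (gnn_param_space d L)
      (b ^ (if \<delta> = 0 then num_params d L else (L + 1) * num_params d L)) I (\<delta> * (D + 1)) {..<m}
      (\<lambda>i \<Theta>. gnn d L \<sigma> \<Theta> (G i))"
  proof (rule cellwise_poly_lift[OF act bound])
    fix C i
    assume "\<And>i. i \<in> {..<m} \<Longrightarrow>
        poly_on coord C J (\<delta> * (D + 1)) (\<lambda>\<Theta>. \<sigma> (Suc L) (readout_preact d L \<sigma> \<Theta> (G i)))"
      and "i \<in> {..<m}"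
    then have h: "poly_on coord C J (\<delta> * (D + 1)) (\<lambda>\<Theta>. gnn d L \<sigma> \<Theta> (G i))"
      unfolding gnn_def readout_preact_def by blast
    show "poly_on coord C I (\<delta> * (D + 1)) (\<lambda>\<Theta>. gnn d L \<sigma> \<Theta> (G i))"
    proof (cases "\<delta> = 0")
      case True
      then show ?thesis using h J(1) by (simp add: poly_on_degree_0)
    next
      case False
      then show ?thesis using h by (simp add: I_def J_def)
    qed
  qed
  then show ?thesis by (simp only: I_def D_def layer_degree.simps)
qed

section \<open>From shattering to a count of cells\<close>

lemma shattered_imp_two_power_le:
  assumes sh: "shattered (f ` X) m x" and \<D>: "finite \<D>" "X \<subseteq> \<Union>\<D>"
    and const: "\<And>E \<Theta> \<Theta>' i. E \<in> \<D> \<Longrightarrow> \<Theta> \<in> E \<Longrightarrow> \<Theta>' \<in> E \<Longrightarrow> i < m \<Longrightarrow>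
      sgn (f \<Theta> (x i) - 1 / 2) = sgn (f \<Theta>' (x i) - 1 / 2)"
  shows "2 ^ m \<le> card \<D>"
proof -
  have "\<forall>\<tau>\<in>Pow {..<m}. \<exists>\<Theta>\<in>X. \<forall>i<m. (i \<in> \<tau> \<longrightarrow> f \<Theta> (x i) \<ge> 2 / 3) \<and> (i \<notin> \<tau> \<longrightarrow> f \<Theta> (x i) \<le> 1 / 3)"
  proof
    fix \<tau> :: "nat set"
    show "\<exists>\<Theta>\<in>X. \<forall>i<m. (i \<in> \<tau> \<longrightarrow> f \<Theta> (x i) \<ge> 2 / 3) \<and> (i \<notin> \<tau> \<longrightarrow> f \<Theta> (x i) \<le> 1 / 3)"
      using sh[unfolded shattered_def, rule_format, of "\<lambda>i. i \<in> \<tau>"] by (simp add: image_iff Bex_def) blast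
  qed
  then obtain \<theta> where \<theta>: "\<And>\<tau>. \<tau> \<subseteq> {..<m} \<Longrightarrow> \<theta> \<tau> \<in> X"
    "\<And>\<tau> i. \<tau> \<subseteq> {..<m} \<Longrightarrow> i < m \<Longrightarrow> i \<in> \<tau> \<Longrightarrow> f (\<theta> \<tau>) (x i) \<ge> 2 / 3"
    "\<And>\<tau> i. \<tau> \<subseteq> {..<m} \<Longrightarrow> i < m \<Longrightarrow> i \<notin> \<tau> \<Longrightarrow> f (\<theta> \<tau>) (x i) \<le> 1 / 3"
    by (metis PowI)
  have "\<forall>\<tau>\<in>Pow {..<m}. \<exists>E\<in>\<D>. \<theta> \<tau> \<in> E" using \<theta>(1) \<D>(2) by blast
  then obtain cell where cell: "\<And>\<tau>. \<tau> \<subseteq> {..<m} \<Longrightarrow> cell \<tau> \<in> \<D>" "\<And>\<tau>. \<tau> \<subseteq> {..<m} \<Longrightarrow> \<theta> \<tau> \<in> cell \<tau>"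
    by (metis PowI)
  \<comment> \<open>The gap between 1/3 and 2/3 makes the sign relative to 1/2 strict, so one cell
    cannot hold parameters realising different labellings.\<close>
  have sub: "i \<in> \<tau>'" if "\<tau> \<subseteq> {..<m}" "\<tau>' \<subseteq> {..<m}" "cell \<tau> = cell \<tau>'" "i \<in> \<tau>" for \<tau> \<tau>' i
  proof (rule ccontr)
    assume "i \<notin> \<tau>'"
    have i: "i < m" using that by auto
    have "sgn (f (\<theta> \<tau>) (x i) - 1 / 2) = 1" using \<theta>(2)[OF that(1) i that(4)] by simp
    moreover have "sgn (f (\<theta> \<tau>') (x i) - 1 / 2) = -1"
      using \<theta>(3)[OF that(2) i \<open>i \<notin> \<tau>'\<close>] by simp
    moreover have "sgn (f (\<theta> \<tau>) (x i) - 1 / 2) = sgn (f (\<theta> \<tau>') (x i) - 1 / 2)"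
      using cell(2)[OF that(2)] unfolding that(3)[symmetric]
      by (rule const[OF cell(1)[OF that(1)] cell(2)[OF that(1)] _ i])
    ultimately show False by simp
  qed
  have "inj_on cell (Pow {..<m})"
  proof (rule inj_onI)
    fix \<tau> \<tau>' assume "\<tau> \<in> Pow {..<m}" "\<tau>' \<in> Pow {..<m}" "cell \<tau> = cell \<tau>'"
    then show "\<tau> = \<tau>'" using sub[of \<tau> \<tau>'] sub[of \<tau>' \<tau>] by auto
  qed
  then have "card (Pow {..<m}) \<le> card \<D>"
    using \<D>(1) cell(1) by (intro card_inj_on_le[of cell]) auto
  then show ?thesis by (simp add: card_Pow)
qed

text \<open>For positive \<delta>, comparing the outputs with 1/2 is one more cut in P variables,
  which raises \<open>L + 1\<close> to \<open>L + 2\<close>. For \<delta> = 0 the outputs are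
  constant on the cells and this cut has exponent 0.\<close>

lemma shattered_GNN_two_power_le:
  assumes G: "\<And>i. i < m \<Longrightarrow> G i \<in> graph_class d u" and sh: "shattered (GNN_slp d L \<sigma>) m G"
    and \<sigma>: "\<And>s. s \<in> {1..L + 1} \<Longrightarrow> piecewise_polynomial p \<delta> (\<sigma> s)"
    and \<Delta>: "\<And>s. s \<le> L \<Longrightarrow> layer_degree \<delta> s + 1 \<le> \<Delta>" "layer_degree \<delta> (Suc L) \<le> \<Delta>"
    and pos: "d \<ge> 1" "u \<ge> 1" "p \<ge> 1"
  shows "2 ^ m \<le> (4 * (m * (u * d) * (2 * p)) * \<Delta> + 2) ^
    (if \<delta> = 0 then num_params d L else (L + 2) * num_params d L)"
proof -
  define b where "b = 4 * (m * (u * d) * (2 * p)) * \<Delta> + 2"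
  define I where "I = (if \<delta> = 0 then {} else all_params d L)"
  define e where "e = (if \<delta> = 0 then 0 else num_params d L)"
  define N where "N = (if \<delta> = 0 then num_params d L else (L + 1) * num_params d L)"
  have I: "finite I" "card I \<le> e" using card_all_params by (auto simp: I_def e_def)
  have "cellwise_poly coord (gnn_param_space d L) (b ^ N) I (layer_degree \<delta> (Suc L)) {..<m}
      (\<lambda>i \<Theta>. gnn d L \<sigma> \<Theta> (G i))"
    unfolding I_def N_def
    using \<sigma> by (intro cellwise_gnn[where u = u and p = p and \<Delta> = \<Delta>] G \<Delta>(1) pos) (simp_all add: b_def)
  from cellwise_poly_sign_cover[OF I(1) finite_lessThan eq_refl[OF card_lessThan] this, of "1 / 2"] obtain \<D> where
    \<D>: "finite \<D>" "\<Union>\<D> = gnn_param_space d L"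
      "card \<D> \<le> b ^ N * (4 * m * layer_degree \<delta> (Suc L) + 2) ^ card I"
    and const: "\<forall>E\<in>\<D>. \<forall>x\<in>E. \<forall>y\<in>E. \<forall>k\<in>{..<m}.
      sgn (gnn d L \<sigma> x (G k) - 1 / 2) = sgn (gnn d L \<sigma> y (G k) - 1 / 2)"
    by (elim exE conjE)
  have "2 ^ m \<le> card \<D>"
  proof (rule shattered_imp_two_power_le[OF sh[unfolded GNN_slp_def] \<D>(1)])
    show "gnn_param_space d L \<subseteq> \<Union>\<D>" by (simp add: \<D>(2))
    show "sgn (gnn d L \<sigma> \<Theta> (G i) - 1 / 2) = sgn (gnn d L \<sigma> \<Theta>' (G i) - 1 / 2)"
      if "E \<in> \<D>" "\<Theta> \<in> E" "\<Theta>' \<in> E" "i < m" for E \<Theta> \<Theta>' i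
      using const that by blast
  qed
  also have "\<dots> \<le> b ^ N * (4 * m * layer_degree \<delta> (Suc L) + 2) ^ card I" by (rule \<D>(3))
  also have "\<dots> \<le> b ^ N * b ^ e"
  proof (rule mult_left_mono)
    have "m * 1 * 1 \<le> m * (u * d) * (2 * p)"
      using pos by (intro mult_le_mono) simp_all
    then have "4 * m * layer_degree \<delta> (Suc L) \<le> 4 * (m * (u * d) * (2 * p)) * \<Delta>"
      using \<Delta>(2) by (intro mult_le_mono) simp_all
    then have "(4 * m * layer_degree \<delta> (Suc L) + 2) ^ card I \<le> b ^ card I"
      unfolding b_def by (intro power_mono) simp_all
    also have "\<dots> \<le> b ^ e" using I(2) by (intro power_increasing) (simp_all add: b_def)
    finally show "(4 * m * layer_degree \<delta> (Suc L) + 2) ^ card I \<le> b ^ e" .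
  qed simp
  also have "\<dots> = b ^ (if \<delta> = 0 then num_params d L else (L + 2) * num_params d L)"
    by (simp add: N_def e_def flip: power_add) (simp add: algebra_simps)
  finally show ?thesis by (simp only: b_def)
qed

section \<open>The VC dimension bound\<close>

text \<open>Splitting \<open>A * x\<close> as \<open>x / (4 * N)\<close> times
  \<open>4 * N * A\<close>, the inequality ln z \<le> z - 1 bounds the first part by
  \<open>x / 4\<close>, which is absorbed on the left because ln 2 \<ge> 1/2.\<close>

lemma le_4_mult_ln_if_le_mult_ln:
  fixes x N A :: real
  assumes x: "x > 0" and N: "N > 0" and A: "A > 0" and le: "x * ln 2 \<le> N * ln (A * x)"
  shows "x \<le> 4 * N * ln (4 * N * A)"
proof -
  have "ln (1 / 2 :: real) \<le> 1 / 2 - 1" by (rule ln_le_minus_one) simp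
  then have "1 / 2 \<le> ln (2 :: real)" by (simp add: ln_div)
  then have "x * (1 / 2) \<le> x * ln 2" using x by (intro mult_left_mono) simp_all
  also note le
  also have "A * x = x / (4 * N) * (4 * N * A)" using N by simp
  also have "ln (x / (4 * N) * (4 * N * A)) = ln (x / (4 * N)) + ln (4 * N * A)"
    using x N A by (intro ln_mult_pos) simp_all
  also have "N * (ln (x / (4 * N)) + ln (4 * N * A)) \<le> N * (x / (4 * N) - 1 + ln (4 * N * A))"
    using x N by (intro mult_left_mono add_right_mono ln_le_minus_one) simp_all
  also have "\<dots> = x / 4 - N + N * ln (4 * N * A)" using N by (simp add: field_simps)
  finally show ?thesis using N by simp
qed

lemma le_mult_ln_if_two_power_le:
  fixes m E a A Y :: nat
  assumes m: "m > 0" and le: "2 ^ m \<le> (a * m + 2) ^ E" and E: "E > 0" and a: "a > 0"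
    and Y: "4 * E * (3 * a) \<le> Y"
  shows "real m \<le> 4 * real E * ln (real Y)"
proof -
  have "2 ^ m \<le> (3 * a * m) ^ E"
    using m a by (intro order_trans[OF le] power_mono) (auto simp: Suc_le_eq[symmetric] intro: order_trans[of _ "a * m + 2 * (a * m)"])
  then have "real (2 ^ m) \<le> real ((3 * a * m) ^ E)" by (simp only: of_nat_le_iff)
  then have "(2 :: real) ^ m \<le> (real (3 * a) * real m) ^ E" by simp
  then have "ln ((2 :: real) ^ m) \<le> ln ((real (3 * a) * real m) ^ E)"
    using m a by (subst ln_le_cancel_iff) simp_all
  then have "real m * ln 2 \<le> real E * ln (real (3 * a) * real m)"
    using m a by (simp add: ln_realpow)
  then have "real m \<le> 4 * real E * ln (4 * real E * real (3 * a))"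
    using m E a by (intro le_4_mult_ln_if_le_mult_ln) simp_all
  also have "\<dots> \<le> 4 * real E * ln (real Y)"
  proof (intro mult_left_mono)
    have "real (4 * E * (3 * a)) \<le> real Y" using Y by (simp only: of_nat_le_iff)
    then have "4 * real E * real (3 * a) \<le> real Y" by simp
    then show "ln (4 * real E * real (3 * a)) \<le> ln (real Y)"
      using E a by (intro ln_mono) simp_all
  qed simp
  finally show ?thesis .
qed

text \<open>The constant is 4 * 3 * 8: 4 from solving for \<open>m\<close>, 3 from
  \<open>L + 2 \<le> 3 * L\<close>, and 8 from the power of \<open>y\<close> inside the logarithm.
  The case \<delta> = 1 is included, as ln 1 = 0.\<close>

lemma shattered_GNN_le:
  assumes G: "\<And>i. i < m \<Longrightarrow> G i \<in> graph_class d u" and sh: "shattered (GNN_slp d L \<sigma>) m G"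
    and \<sigma>: "\<And>s. s \<in> {1..L + 1} \<Longrightarrow> piecewise_polynomial p \<delta> (\<sigma> s)"
    and pos: "d \<ge> 1" "L \<ge> 1" "u \<ge> 1" "p \<ge> 1"
  defines "P \<equiv> num_params d L"
  shows "real m \<le> 96 *
    (if \<delta> = 0 then real P * ln (real p * real u * real P)
     else real L * real P * ln (real p * real u * real P) + (real L)\<^sup>2 * real P * ln (real \<delta>))"
proof -
  define y where "y = p * u * P"
  \<comment> \<open>These bounds absorb every factor inside the logarithm into powers of
    \<open>y\<close>; \<open>P \<ge> 5\<close> gives \<open>P ^ 3 \<ge> 125\<close>, which swallows
    the numeral 96.\<close>
  have P: "P \<ge> d" "P \<ge> L + 2" "P \<ge> 5"
  proof -
    define q r where "q = d * (d * L)" and "r = d * (L + 1)"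
    have "1 * (1 * L) \<le> d * (d * L)" "1 * (L + 1) \<le> d * (L + 1)" "d * 1 \<le> d * (L + 1)"
      using pos by (intro mult_le_mono; simp)+
    then have "L \<le> q" "L + 1 \<le> r" "d \<le> r" by (simp_all only: q_def r_def mult_1 mult_1_right)
    moreover have "P = 2 * q + r + 1"
      by (simp add: P_def num_params_def q_def r_def algebra_simps)
    ultimately show "P \<ge> d" "P \<ge> L + 2" "P \<ge> 5" using pos by linarith+
  qed
  have y: "P \<le> y" "p * u \<le> y" "y \<ge> 1"
    using pos P by (auto simp: y_def)
  have ln_y: "ln (real y) \<ge> 0" using y by simp
  have y_eq: "real y = real p * real u * real P" by (simp add: y_def)
  have P_cube: "125 \<le> P ^ 3" using power_mono[OF P(3), of 3] by simp
  show ?thesis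
  proof (cases "m = 0")
    case True
    have "real P * ln (real y) \<ge> 0" "real L * real P * ln (real y) \<ge> 0" using ln_y by simp_all
    moreover have "(real L)\<^sup>2 * real P * ln (real \<delta>) \<ge> 0" if "\<delta> \<noteq> 0" using that by simp
    ultimately show ?thesis unfolding y_eq[symmetric] using True by auto
  next
    case False
    show ?thesis
    proof (cases "\<delta> = 0")
      case True
      have "2 ^ m \<le> (4 * (m * (u * d) * (2 * p)) * 1 + 2) ^
          (if \<delta> = 0 then num_params d L else (L + 2) * num_params d L)"
        using True pos by (intro shattered_GNN_two_power_le[OF G sh \<sigma>]) (simp_all add: layer_degree_0)
      then have le: "2 ^ m \<le> (8 * u * d * p * m + 2) ^ P"
        using True by (simp add: P_def mult_ac)
      have "4 * P * (3 * (8 * u * d * p)) = 96 * (P * d * (p * u))" by simp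
      also have "\<dots> \<le> P ^ 3 * (P * P * (p * u))"
        using P P_cube by (intro mult_le_mono) simp_all
      also have "\<dots> \<le> y ^ 3 * (y * y * y)" using y by (intro mult_le_mono power_mono) simp_all
      also have "\<dots> = y ^ 6" by (simp add: eval_nat_numeral)
      finally have "4 * P * (3 * (8 * u * d * p)) \<le> y ^ 6" .
      then have "real m \<le> 4 * real P * ln (real (y ^ 6))"
        using False P pos by (intro le_mult_ln_if_two_power_le[OF _ le]) simp_all
      also have "\<dots> = 24 * (real P * ln (real y))" using y by (simp add: ln_realpow)
      also have "\<dots> \<le> 96 * (real P * ln (real y))" using ln_y by (intro mult_right_mono) simp_all
      finally show ?thesis using True by (simp add: y_eq)
    next
      case \<delta>: False
      \<comment> \<open>One bound for the degrees of all preactivations and of the output.\<close>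
      define \<Delta> where "\<Delta> = (L + 1) * \<delta> ^ (L + 1)"
      have deg: "layer_degree \<delta> s + 1 \<le> \<Delta>" if "s \<le> L" for s
      proof -
        have "layer_degree \<delta> s \<le> s * \<delta> ^ s" using \<delta> by (intro layer_degree_le) simp
        also have "\<dots> \<le> L * \<delta> ^ (L + 1)"
          using that \<delta> by (intro mult_le_mono power_increasing) simp_all
        finally have "layer_degree \<delta> s \<le> L * \<delta> ^ (L + 1)" .
        moreover have "1 \<le> \<delta> ^ (L + 1)" using \<delta> by (intro one_le_power) simp
        ultimately show ?thesis unfolding \<Delta>_def add_mult_distrib mult_1 by (rule add_mono)
      qed
      have deg': "layer_degree \<delta> (Suc L) \<le> \<Delta>"
        unfolding \<Delta>_def using layer_degree_le[of \<delta> "Suc L"] \<delta> by simp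
      have "2 ^ m \<le> (4 * (m * (u * d) * (2 * p)) * \<Delta> + 2) ^
          (if \<delta> = 0 then num_params d L else (L + 2) * num_params d L)"
        using pos by (intro shattered_GNN_two_power_le[OF G sh \<sigma> deg deg']) simp_all
      then have le: "2 ^ m \<le> (8 * u * d * p * \<Delta> * m + 2) ^ ((L + 2) * P)"
        using \<delta> by (simp add: P_def mult_ac)
      have "4 * ((L + 2) * P) * (3 * (8 * u * d * p * \<Delta>)) =
          96 * ((L + 2) * P * d * (L + 1) * (p * u)) * \<delta> ^ (L + 1)"
      proof -
        have "4 * (l * P) * (3 * (8 * u * d * p * (k * z))) = 96 * (l * P * d * k * (p * u)) * z"
          for l k z :: nat by simp
        then show ?thesis unfolding \<Delta>_def .
      qed
      also have "\<dots> \<le> P ^ 3 * (P * P * P * P * (p * u)) * \<delta> ^ (L + 1)"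
        using P P_cube by (intro mult_le_mono) simp_all
      also have "\<dots> \<le> y ^ 3 * (y * y * y * y * y) * \<delta> ^ (L + 1)"
        using y by (intro mult_le_mono power_mono) simp_all
      also have "y ^ 3 * (y * y * y * y * y) = y ^ 8" by (simp add: eval_nat_numeral)
      finally have "4 * ((L + 2) * P) * (3 * (8 * u * d * p * \<Delta>)) \<le> y ^ 8 * \<delta> ^ (L + 1)" .
      then have "real m \<le> 4 * real ((L + 2) * P) * ln (real (y ^ 8 * \<delta> ^ (L + 1)))"
        using False P pos \<delta> by (intro le_mult_ln_if_two_power_le[OF _ le]) (simp_all add: \<Delta>_def)
      also have "real (y ^ 8 * \<delta> ^ (L + 1)) = real y ^ 8 * real \<delta> ^ (L + 1)" by simp
      also have "ln (real y ^ 8 * real \<delta> ^ (L + 1)) = 8 * ln (real y) + real (L + 1) * ln (real \<delta>)"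
        using y \<delta> by (subst ln_mult_pos) (simp_all add: ln_realpow del: power_Suc)
      also have "4 * real ((L + 2) * P) * (8 * ln (real y) + real (L + 1) * ln (real \<delta>)) \<le>
          4 * real (3 * L * P) * (8 * ln (real y) + real (2 * L) * ln (real \<delta>))"
        using pos ln_y \<delta>
        by (intro mult_mono add_mono mult_right_mono of_nat_mono mult_left_mono order_refl) simp_all
      also have "\<dots> = 96 * (real L * real P * ln (real y)) + 24 * ((real L)\<^sup>2 * real P * ln (real \<delta>))"
        by (simp add: algebra_simps power2_eq_square)
      also have "\<dots> \<le> 96 * (real L * real P * ln (real y)) + 96 * ((real L)\<^sup>2 * real P * ln (real \<delta>))"
        using \<delta> by (intro add_left_mono mult_right_mono) simp_all
      finally show ?thesis using \<delta> by (simp add: y_eq algebra_simps)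
    qed
  qed
qed

theorem theorem6:
  shows "\<exists>c::real. c > 0 \<and>
    (\<forall>(d::nat) (L::nat) (p::nat) (\<delta>::nat) (\<sigma> :: nat \<Rightarrow> real \<Rightarrow> real) (u::nat).
       d \<ge> 1 \<longrightarrow> L \<ge> 1 \<longrightarrow> p > 0 \<longrightarrow> u \<ge> 1 \<longrightarrow>
       (\<forall>t\<in>{1..L + 1}. piecewise_polynomial p \<delta> (\<sigma> t)) \<longrightarrow>
       (let P = real (num_params d L) in
          ereal_of_enat (VC_dim (graph_class d u) (GNN_slp d L \<sigma>)) \<le>
          ereal (c *
            (if \<delta> = 0 then P * ln (real p * real u * P)
             else if \<delta> = 1 then real L * P * ln (real p * real u * P)
             else real L * P * ln (real p * real u * P) + (real L)\<^sup>2 * P * ln (real \<delta>)))))"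
proof (intro exI[of _ 96] conjI allI impI)
  fix d L p \<delta> u :: nat and \<sigma> :: "nat \<Rightarrow> real \<Rightarrow> real"
  assume pos: "d \<ge> 1" "L \<ge> 1" "p > 0" "u \<ge> 1"
    and \<sigma>: "\<forall>t\<in>{1..L + 1}. piecewise_polynomial p \<delta> (\<sigma> t)"
  define P where "P = real (num_params d L)"
  define B where "B = 96 *
    (if \<delta> = 0 then P * ln (real p * real u * P)
     else if \<delta> = 1 then real L * P * ln (real p * real u * P)
     else real L * P * ln (real p * real u * P) + (real L)\<^sup>2 * P * ln (real \<delta>))"
  have le: "real m \<le> B"
    if "\<forall>i<m. G i \<in> graph_class d u" "shattered (GNN_slp d L \<sigma>) m G" for m G
    using shattered_GNN_le[of m G d u L \<sigma> p \<delta>] that \<sigma> pos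
    by (auto simp: B_def P_def distrib_left)
  have "VC_dim (graph_class d u) (GNN_slp d L \<sigma>) \<le> enat (nat \<lfloor>B\<rfloor>)"
    unfolding VC_dim_def
  proof (rule Sup_least)
    fix k assume "k \<in> {enat m |m. \<exists>G. (\<forall>i<m. G i \<in> graph_class d u) \<and> shattered (GNN_slp d L \<sigma>) m G}"
    then obtain m G where "k = enat m" "\<forall>i<m. G i \<in> graph_class d u" "shattered (GNN_slp d L \<sigma>) m G"
      by blast
    then show "k \<le> enat (nat \<lfloor>B\<rfloor>)" using le by (simp add: le_nat_floor)
  qed
  then have "ereal_of_enat (VC_dim (graph_class d u) (GNN_slp d L \<sigma>)) \<le> ereal (real (nat \<lfloor>B\<rfloor>))"
    by (metis ereal_of_enat_le_iff ereal_of_enat_simps(1))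
  also have "\<dots> \<le> ereal B"
  proof -
    \<comment> \<open>Since \<open>nat\<close> truncates at 0, \<open>B\<close> must be known to be
      nonnegative. This follows from the empty family, which is shattered because the class contains
      the GNN with zero parameters.\<close>
    have "shattered (GNN_slp d L \<sigma>) 0 G" for G :: "nat \<Rightarrow> fgraph"
    proof -
      have "\<lparr>W1 = \<lambda>_. 0\<^sub>m d d, W2 = \<lambda>_. 0\<^sub>m d d, bias = \<lambda>_. 0\<^sub>v d, w_out = 0\<^sub>v d, b_out = 0\<rparr>
          \<in> gnn_param_space d L"
        by (simp add: gnn_param_space_def)
      then show ?thesis unfolding shattered_def GNN_slp_def by blast
    qed
    then have "0 \<le> B" using le[of 0] by force
    then show ?thesis by simp
  qed
  finally show "let P = real (num_params d L) in
      ereal_of_enat (VC_dim (graph_class d u) (GNN_slp d L \<sigma>)) \<le>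
      ereal (96 *
        (if \<delta> = 0 then P * ln (real p * real u * P)
         else if \<delta> = 1 then real L * P * ln (real p * real u * P)
         else real L * P * ln (real p * real u * P) + (real L)\<^sup>2 * P * ln (real \<delta>)))"
    unfolding Let_def B_def P_def .
qed simp

end
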